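(* Let $n\ge2$ and let $U=U_{r,s}(\mathfrak{so}_{2n+1})$ be as in the context, where $r$ is a primitive $d$-th root of unity, $s$ is a primitive $d'$-th root of unity, $r^3\ne s^3$, $r^4\ne s^4$, and $\ell=\mathrm{lcm}(d,d')$. Then the elements $\mathcal E_{k,j}^\ell$ $(1\le k\le j\le n)$, $\mathcal E_{k,j'}^\ell$ $(1\le k<j\le n)$, $\mathcal F_{k,j}^\ell$ $(1\le k\le j\le n)$, $\mathcal F_{k,j'}^\ell$ $(1\le k<j\le n)$ and $\omega_k^\ell-1$, $(\omega_k')^\ell-1$ $(1\le k\le n)$ are central in $U$.
   Context: $\mathbb K=\mathbb Q(r,s)$. $U_{r,s}(\mathfrak{so}_{2n+1})$ is the $\mathbb K$-algebra generated by $e_i,f_i,\omega_i^{\pm1},\omega_i'^{\pm1}$ ($1\le i\le n$) with: $\omega$'s commute, invertible; $\omega_je_i\omega_j^{-1}=\langle\omega_i',\omega_j\rangle e_i$, $\omega_jf_i\omega_j^{-1}=\langle\omega_i',\omega_j\rangle^{-1}f_i$, $\omega_j'e_i\omega_j'^{-1}=\langle\omega_j',\omega_i\rangle^{-1}e_i$, $\omega_j'f_i\omega_j'^{-1}=\langle\omega_j',\omega_i\rangle f_i$, where $\langle\omega_i',\omega_i\rangle=r^2s^{-2}$ ($i<n$), $\langle\omega_n',\omega_n\rangle=rs^{-1}$, $\langle\omega_i',\omega_{i+1}\rangle=r^{-2}$, $\langle\omega_{i+1}',\omega_i\rangle=s^2$ ($i<n$), others $1$; $e_if_j-f_je_i=\delta_{ij}(\omega_i-\omega_i')/(r_i-s_i)$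 ($r_i=r^2,s_i=s^2$ for $i<n$; $r_n=r,s_n=s$); Serre relations $(\mathrm{ad}_le_i)^{1-a_{ij}}(e_j)=0=(\mathrm{ad}_rf_i)^{1-a_{ij}}(f_j)$, $i\ne j$, with $(a_{ij})$ the $B_n$ Cartan matrix ($a_{ii}=2$, $a_{i,i+1}=a_{i+1,i}=-1$ for $i\le n-2$, $a_{n-1,n}=-1$, $a_{n,n-1}=-2$, else $0$), $\mathrm{ad}_l(a)(b)=\sum a_{(1)}bS(a_{(2)})$, $\mathrm{ad}_r(a)(b)=\sum S(a_{(1)})ba_{(2)}$, for the Hopf structure $\Delta(\omega)=\omega\otimes\omega$ on the $\omega$'s, $\Delta(e_i)=e_i\otimes1+\omega_i\otimes e_i$, $\Delta(f_i)=1\otimes f_i+f_i\otimes\omega_i'$, $S(e_i)=-\omega_i^{-1}e_i$, $S(f_i)=-f_i\omega_i'^{-1}$. Root vectors: $\mathcal E_{i,i}=e_i$, $\mathcal E_{i,j}=e_i\mathcal E_{i+1,j}-r^2\mathcal E_{i+1,j}e_i$ ($1\le i<j\le n$), $\mathcal E_{i,n'}=\mathcal E_{i,n}e_n-rs\,e_n\mathcal E_{i,n}$ ($i\le n-1$), $\mathcal E_{i,j'}=\mathcal E_{i,(j+1)'}e_j-s^{-2}e_j\mathcal E_{i,(j+1)'}$ ($1\le i<j\le n-1$); $\mathcal F_{i,i}=f_i$, $\mathcal F_{i,j}=\mathcal F_{i+1,j}f_i-s^2f_i\mathcal F_{i+1,j}$, $\mathcal F_{i,n'}=f_n\mathcal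 F_{i,n}-rs\,\mathcal F_{i,n}f_n$, $\mathcal F_{i,j'}=f_j\mathcal F_{i,(j+1)'}-r^{-2}\mathcal F_{i,(j+1)'}f_j$. *)

theory Defs
  imports Main "HOL-Library.Poly_Mapping"
begin

datatype gen = GE nat | GF nat | GW nat | GWi nat | GW' nat | GW'i nat

datatype word = Word "gen list"

instantiation word :: monoid_add
begin
definition zero_word :: word where "zero_word = Word []"
fun plus_word :: "word \<Rightarrow> word \<Rightarrow> word" where
  "plus_word (Word xs) (Word ys) = Word (xs @ ys)"
instance
proof
  fix a b c :: word
  show "a + b + c = a + (b + c)" by (cases a; cases b; cases c) simp
  show "0 + a = a" by (cases a) (simp add: zero_word_def)
  show "a + 0 = a" by (cases a) (simp add: zero_word_def)
qed
end

text \<open>The free associative 'k-algebra: finitely supported 'k-linear combinations of words,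
  with convolution product (concatenation of words).\<close>
type_synonym 'k freealg = "word \<Rightarrow>\<^sub>0 'k"

definition sc :: "'k::ring_1 \<Rightarrow> 'k freealg" where
  "sc c = Poly_Mapping.single (Word []) c"

definition gn :: "gen \<Rightarrow> 'k::ring_1 freealg" where
  "gn g = Poly_Mapping.single (Word [g]) 1"

abbreviation "ge i \<equiv> gn (GE i)"
abbreviation "gf i \<equiv> gn (GF i)"
abbreviation "gw i \<equiv> gn (GW i)"
abbreviation "gwi i \<equiv> gn (GWi i)"
abbreviation "gw' i \<equiv> gn (GW' i)"
abbreviation "gw'i i \<equiv> gn (GW'i i)"

definition pairing :: "nat \<Rightarrow> 'k::field \<Rightarrow> 'k \<Rightarrow> nat \<Rightarrow> nat \<Rightarrow> 'k" where
  "pairing n r s i j =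
     (if i = j then (if i < n then r^2 * inverse (s^2) else r * inverse s)
      else if j = i + 1 then inverse (r^2)
      else if i = j + 1 then s^2
      else 1)"

definition rr :: "nat \<Rightarrow> 'k::field \<Rightarrow> nat \<Rightarrow> 'k" where
  "rr n r i = (if i < n then r^2 else r)"

definition cartan :: "nat \<Rightarrow> nat \<Rightarrow> nat \<Rightarrow> int" where
  "cartan n i j =
     (if i = j then 2
      else if j = i + 1 \<and> i \<le> n - 2 then -1
      else if i = j + 1 \<and> j \<le> n - 2 then -1
      else if i = n - 1 \<and> j = n then -1
      else if i = n \<and> j = n - 1 then -2
      else 0)"

text \<open>Left adjoint action of e_i and right adjoint action of f_i, unfolded via the Hopf structure:
  ad_l(e_i)(b) = e_i b + \<omega>_i b S(e_i) = e_i b - \<omega>_i b \<omega>_i^{-1} e_i,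
  ad_r(f_i)(b) = b f_i + S(f_i) b \<omega>_i' = b f_i - f_i \<omega>_i'^{-1} b \<omega>_i'.\<close>
definition adl :: "nat \<Rightarrow> 'k::ring_1 freealg \<Rightarrow> 'k freealg" where
  "adl i b = ge i * b - gw i * b * gwi i * ge i"

definition adr :: "nat \<Rightarrow> 'k::ring_1 freealg \<Rightarrow> 'k freealg" where
  "adr i b = b * gf i - gf i * gw'i i * b * gw' i"

definition gen_idx :: "gen \<Rightarrow> nat" where
  "gen_idx g = (case g of GE i \<Rightarrow> i | GF i \<Rightarrow> i | GW i \<Rightarrow> i | GWi i \<Rightarrow> i | GW' i \<Rightarrow> i | GW'i i \<Rightarrow> i)"

text \<open>The set of relators (elements required to vanish). Generators with an index outside
  {1..n} are killed, so that the quotient is generated by the 6n generators only.\<close>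
definition rels :: "nat \<Rightarrow> 'k::field \<Rightarrow> 'k \<Rightarrow> 'k freealg set" where
  "rels n r s =
     {gn g | g. gen_idx g \<notin> {1..n}}
   \<union> (\<Union>i\<in>{1..n}. \<Union>j\<in>{1..n}.
       { gw i * gw j - gw j * gw i, gw i * gw' j - gw' j * gw i, gw' i * gw' j - gw' j * gw' i })
   \<union> (\<Union>i\<in>{1..n}. { gw i * gwi i - 1, gwi i * gw i - 1, gw' i * gw'i i - 1, gw'i i * gw' i - 1 })
   \<union> (\<Union>i\<in>{1..n}. \<Union>j\<in>{1..n}.
       { gw j * ge i * gwi j - sc (pairing n r s i j) * ge i,
         gw j * gf i * gwi j - sc (inverse (pairing n r s i j)) * gf i,
         gw' j * ge i * gw'i j - sc (inverse (pairing n r s j i)) * ge i,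
         gw' j * gf i * gw'i j - sc (pairing n r s j i) * gf i,
         ge i * gf j - gf j * ge i
           - (if i = j then sc (inverse (rr n r i - rr n s i)) * (gw i - gw' i) else 0) })
   \<union> (\<Union>i\<in>{1..n}. \<Union>j\<in>{1..n}. if i = j then {} else
       { (adl i ^^ nat (1 - cartan n i j)) (ge j), (adr i ^^ nat (1 - cartan n i j)) (gf j) })"

inductive_set ideal_gen :: "'a::ring_1 set \<Rightarrow> 'a set" for R where
  base: "x \<in> R \<Longrightarrow> x \<in> ideal_gen R"
| zero: "0 \<in> ideal_gen R"
| add: "x \<in> ideal_gen R \<Longrightarrow> y \<in> ideal_gen R \<Longrightarrow> x + y \<in> ideal_gen R"
| mult: "x \<in> ideal_gen R \<Longrightarrow> a * x * b \<in> ideal_gen R"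

text \<open>U = free algebra / ideal_gen (rels n r s). An element x (a representative in the free algebra)
  is central in U iff [x,y] lies in the ideal for every y.\<close>
definition Ucentral :: "nat \<Rightarrow> 'k::field \<Rightarrow> 'k \<Rightarrow> 'k freealg \<Rightarrow> bool" where
  "Ucentral n r s x \<longleftrightarrow> (\<forall>y. x * y - y * x \<in> ideal_gen (rels n r s))"

text \<open>Eaux m j = \<E>_{j-m, j}.\<close>
primrec Eaux :: "'k::field \<Rightarrow> nat \<Rightarrow> nat \<Rightarrow> 'k freealg" where
  "Eaux r 0 j = ge j"
| "Eaux r (Suc m) j = ge (j - Suc m) * Eaux r m j - sc (r^2) * Eaux r m j * ge (j - Suc m)"

definition Ev :: "'k::field \<Rightarrow> nat \<Rightarrow> nat \<Rightarrow> 'k freealg" where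
  "Ev r k j = Eaux r (j - k) j"

text \<open>Epaux m k = \<E>_{k, (n-m)'}.\<close>
primrec Epaux :: "nat \<Rightarrow> 'k::field \<Rightarrow> 'k \<Rightarrow> nat \<Rightarrow> nat \<Rightarrow> 'k freealg" where
  "Epaux n r s 0 k = Ev r k n * ge n - sc (r * s) * ge n * Ev r k n"
| "Epaux n r s (Suc m) k = Epaux n r s m k * ge (n - Suc m)
      - sc (inverse (s^2)) * ge (n - Suc m) * Epaux n r s m k"

definition Epv :: "nat \<Rightarrow> 'k::field \<Rightarrow> 'k \<Rightarrow> nat \<Rightarrow> nat \<Rightarrow> 'k freealg" where
  "Epv n r s k j = Epaux n r s (n - j) k"

primrec Faux :: "'k::field \<Rightarrow> nat \<Rightarrow> nat \<Rightarrow> 'k freealg" where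
  "Faux s 0 j = gf j"
| "Faux s (Suc m) j = Faux s m j * gf (j - Suc m) - sc (s^2) * gf (j - Suc m) * Faux s m j"

definition Fv :: "'k::field \<Rightarrow> nat \<Rightarrow> nat \<Rightarrow> 'k freealg" where
  "Fv s k j = Faux s (j - k) j"

primrec Fpaux :: "nat \<Rightarrow> 'k::field \<Rightarrow> 'k \<Rightarrow> nat \<Rightarrow> nat \<Rightarrow> 'k freealg" where
  "Fpaux n r s 0 k = gf n * Fv s k n - sc (r * s) * Fv s k n * gf n"
| "Fpaux n r s (Suc m) k = gf (n - Suc m) * Fpaux n r s m k
      - sc (inverse (r^2)) * Fpaux n r s m k * gf (n - Suc m)"

definition Fpv :: "nat \<Rightarrow> 'k::field \<Rightarrow> 'k \<Rightarrow> nat \<Rightarrow> nat \<Rightarrow> 'k freealg" where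
  "Fpv n r s k j = Fpaux n r s (n - j) k"

definition primitive_root :: "nat \<Rightarrow> 'k::field \<Rightarrow> bool" where
  "primitive_root d x \<longleftrightarrow> d > 0 \<and> x ^ d = 1 \<and> (\<forall>k. 0 < k \<and> k < d \<longrightarrow> x ^ k \<noteq> 1)"

end

theory Submission
  imports Defs HOL.Vector_Spaces
begin

text \<open>
  Call \<open>y\<close> and \<open>z\<close> \<open>q\<close>-commuting if \<open>yz = c zy\<close> for a scalar \<open>c\<close>. If \<open>Z y = a y Z + y\<^sub>1\<close>,
  \<open>Z y\<^sub>1 = b y\<^sub>1 Z\<close> with distinct \<open>l\<close>-th roots of unity \<open>a, b\<close>, then the coefficient
  \<open>(a\<^sup>l - b\<^sup>l) / (a - b)\<close> of \<open>y\<^sub>1 Z\<^sup>l\<^sup>-\<^sup>1\<close> in \<open>Z\<^sup>l y\<close> vanishes and \<open>Z\<^sup>l\<close> commutes with \<open>y\<close>; the same holds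
  for chains of length three. For a root vector \<open>Z\<close> in row \<open>k\<close> (that is, \<open>E\<^sub>k\<^sub>,\<^sub>j\<close> or \<open>E\<^sub>k\<^sub>,\<^sub>j\<^sub>'\<close>) such chains
  exist for \<open>e\<^sub>i\<close> with \<open>i > k\<close> and for \<open>f\<^sub>i\<close> with \<open>i \<noteq> k\<close>, because neighbours in a row \<open>q\<close>-commute. The
  remaining generators are reached through commutators. The commutator of a vector of row \<open>m\<close> with
  a suitable \<open>f\<^sub>i\<close>, \<open>i > m\<close>, is its predecessor in the row times a unit, so commuting with any vector
  of row \<open>m\<close> and with these \<open>f\<^sub>i\<close> implies commuting with \<open>e\<^sub>m\<close>. This gives \<open>e\<^sub>k\<close>, and also \<open>e\<^sub>k\<^sub>-\<^sub>1\<close>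
  because the last vector of row \<open>k - 1\<close> \<open>q\<close>-commutes with everything in row \<open>k\<close>. For \<open>E\<^sub>k\<^sub>,\<^sub>j\<^sub>'\<close>, the
  generator \<open>f\<^sub>k\<close> is reached in the same way from an iterated bracket of \<open>f\<^sub>k, \<dots>, f\<^sub>j\<^sub>-\<^sub>1\<close>. The
  vectors \<open>F\<close> are the vectors \<open>E\<close> of the opposite algebra with \<open>r\<close> and \<open>s\<close> exchanged.
\<close>

section \<open>Brackets and q-commutation\<close>

text \<open>The scalar action is a parameter, so that the same lemmas serve a ring and its
  opposite.\<close>

locale scalar_algebra = vector_space scale
  for scale :: "'k::field \<Rightarrow> 'a::ring_1 \<Rightarrow> 'a" (infixr "\<star>" 75) +
  assumes scale_mult_left: "(c \<star> x) * y = c \<star> (x * y)"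
    and scale_mult_right: "x * (c \<star> y) = c \<star> (x * y)"
begin

lemmas expand = scale_mult_left scale_mult_right algebra_simps power2_eq_square

definition br :: "'k \<Rightarrow> 'a \<Rightarrow> 'a \<Rightarrow> 'a" where
  "br c x y = x * y - c \<star> (y * x)"

definition qc :: "'k \<Rightarrow> 'a \<Rightarrow> 'a \<Rightarrow> bool" where
  "qc c x y \<longleftrightarrow> x * y = c \<star> (y * x)"

lemma qcD: "qc c x y \<Longrightarrow> x * y = c \<star> (y * x)"
  by (simp add: qc_def)

lemma qc_1: "qc 1 x y \<longleftrightarrow> x * y = y * x"
  by (simp add: qc_def)

lemma qc_mult:
  assumes "qc c x y" "qc d x z"
  shows "qc (c * d) x (y * z)"
proof -
  have "x * (y * z) = (x * y) * z" by (simp add: mult.assoc)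
  also have "\<dots> = c \<star> (y * (x * z))"
    using assms(1) by (simp add: qc_def expand)
  also have "\<dots> = (c * d) \<star> (y * z * x)"
    using assms(2) by (simp add: qc_def expand)
  finally show ?thesis by (simp add: qc_def)
qed

lemma qc_mult_left:
  assumes "qc c y x" "qc d z x"
  shows "qc (c * d) (y * z) x"
proof -
  have "y * z * x = y * (z * x)" by (simp add: mult.assoc)
  also have "\<dots> = d \<star> ((y * x) * z)"
    using assms(2) by (simp add: qc_def expand)
  also have "\<dots> = (c * d) \<star> (x * (y * z))"
    using assms(1) by (simp add: qc_def expand)
  finally show ?thesis by (simp add: qc_def)
qed

lemma qc_scale: "qc c x y \<Longrightarrow> qc c x (d \<star> y)"
  by (simp add: qc_def expand)

lemma qc_scale_left: "qc c x y \<Longrightarrow> qc c (d \<star> x) y"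
  by (simp add: qc_def expand)

lemma qc_diff: "qc c x y \<Longrightarrow> qc c x z \<Longrightarrow> qc c x (y - z)"
  by (simp add: qc_def expand)

lemma qc_diff_left: "qc c y x \<Longrightarrow> qc c z x \<Longrightarrow> qc c (y - z) x"
  by (simp add: qc_def expand)

lemma qc_uminus: "qc c x y \<Longrightarrow> qc c x (- y)"
  by (simp add: qc_def)

lemma qc_br:
  assumes "qc c x y" "qc d x z"
  shows "qc (c * d) x (br t y z)"
  unfolding br_def
  using qc_mult[OF assms] qc_mult[OF assms(2) assms(1)]
  by (intro qc_diff qc_scale) (simp_all add: mult.commute)

lemma qc_br_left:
  assumes "qc c y x" "qc d z x"
  shows "qc (c * d) (br t y z) x"
  unfolding br_def
  using qc_mult_left[OF assms] qc_mult_left[OF assms(2) assms(1)]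
  by (intro qc_diff_left qc_scale_left) (simp_all add: mult.commute)

lemma qc_sym:
  assumes "qc c x y" "c * d = 1"
  shows "qc d y x"
  using assms by (simp add: qc_def mult.commute)

lemma qc_eqI: "qc c x y \<Longrightarrow> c = d \<Longrightarrow> qc d x y"
  by simp

lemma qc_1_sym: "qc 1 x y \<Longrightarrow> qc 1 y x"
  by (simp add: qc_def)

lemma qc_br_1: "qc 1 x y \<Longrightarrow> qc d x z \<Longrightarrow> qc d x (br t y z)"
  using qc_br[of 1 x y d z] by simp

lemma qc_br_2: "qc d x y \<Longrightarrow> qc 1 x z \<Longrightarrow> qc d x (br t y z)"
  using qc_br[of d x y 1 z] by simp

lemma qc_br_left_1: "qc 1 y x \<Longrightarrow> qc d z x \<Longrightarrow> qc d (br t y z) x"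
  using qc_br_left[of 1 y x d z] by simp

lemma qc_br_left_2: "qc d y x \<Longrightarrow> qc 1 z x \<Longrightarrow> qc d (br t y z) x"
  using qc_br_left[of d y x 1 z] by simp

lemma qc_power: "qc c x y \<Longrightarrow> qc (c ^ m) x (y ^ m)"
proof (induction m)
  case (Suc m)
  then show ?case using qc_mult[of c x y "c ^ m" "y ^ m"] by simp
qed (simp add: qc_def)

lemma qc_power_left: "qc c x y \<Longrightarrow> qc (c ^ m) (x ^ m) y"
proof (induction m)
  case (Suc m)
  then show ?case using qc_mult_left[of c x y "c ^ m" "x ^ m"] by simp
qed (simp add: qc_def)

text \<open>Both sides say \<open>y * y * x - (a + b) \<star> (y * x * y) + (a * b) \<star> (x * y *
  y) = 0\<close>, which is symmetric in \<open>a\<close> and \<open>b\<close>: a Serre relation can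
  be read with its two scalars in either order.\<close>

lemma qc_swap_br:
  assumes "qc b y (br a y x)"
  shows "qc a y (br b y x)"
  using assms by (simp add: qc_def br_def expand)

lemma br_inverse:
  assumes "a * b = 1"
  shows "br a x y = - a \<star> br b y x"
  using assms by (simp add: br_def expand)

text \<open>The two nestings differ only by terms that contain the commutator of the outer entries.
  This allows a root vector to be built up from either end.\<close>

lemma br_assoc:
  assumes "x * z = z * x"
  shows "br a x (br b y z) = br b (br a x y) z"
proof -
  have "br a x (br b y z) - br b (br a x y) z
     = - b \<star> ((x * z - z * x) * y) + a \<star> (y * (x * z - z * x))"
    by (simp add: br_def expand)
  then show ?thesis using assms by simp
qed

lemma br_zero [simp]: "br a 0 x = 0" "br a x 0 = 0"
  by (simp_all add: br_def)

lemma br_scale: "br a (c \<star> x) y = c \<star> br a x y" "br a x (c \<star> y) = c \<star> br a x y"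
  by (simp_all add: br_def expand)

lemma br_uminus: "br a (- x) y = - br a x y" "br a x (- y) = - br a x y"
  by (simp_all add: br_def)

lemma br_br_derivation: "br 1 (br c x y) z = br c (br 1 x z) y + br c x (br 1 y z)"
  by (simp add: br_def expand)

lemma br_derivation_right: "br 1 z (br c x y) = br c (br 1 z x) y + br c x (br 1 z y)"
  by (simp add: br_def expand)

lemma br_eq_0_iff: "br c x y = 0 \<longleftrightarrow> qc c x y"
  by (simp add: br_def qc_def)

lemma br_left_comm:
  assumes "qc 1 x u"
  shows "br b x (br a u y) = br a u (br b x y)"
proof -
  have "br b x (br a u y) - br a u (br b x y)
    = (x * u - u * x) * y + (a * b) \<star> (y * (u * x - x * u))"
    by (simp add: br_def expand)
  then show ?thesis using assms by (simp add: qc_def)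
qed

text \<open>The twisted commutator of \<open>br p x y\<close> and \<open>br p y z\<close> with
  scalar \<open>p * q\<close> is computed twice, once through \<open>h1\<close> and once through
  \<open>h2\<close>. Comparing the results gives \<open>p + q\<close> times the commutator of
  \<open>y\<close> with the triple bracket.\<close>

lemma rank3_middle_commutes:
  assumes xz: "x * z = z * x"
    and h1: "qc q (br p x y) y" and h2: "qc q y (br p y z)" and "p + q \<noteq> 0"
  shows "qc 1 y (br p (br p x y) z)"
proof -
  define x' z' W where "x' = br p x y" and "z' = br p y z" and "W = br p x' z"
  have W: "W = br p x z'"
    unfolding W_def x'_def z'_def by (rule br_assoc[OF xz, symmetric])
  have "q \<star> (y * W) - p \<star> (W * y) - (x' * z' - (p * q) \<star> (z' * x'))
     = - ((x' * y - q \<star> (y * x')) * z) + (p * p) \<star> (z * (x' * y - q \<star> (y * x')))"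
    unfolding W_def z'_def by (simp add: br_def expand)
  moreover have "q \<star> (W * y) - p \<star> (y * W) - (x' * z' - (p * q) \<star> (z' * x'))
     = - (x * (y * z' - q \<star> (z' * y))) + (p * p) \<star> ((y * z' - q \<star> (z' * y)) * x)"
    unfolding W x'_def by (simp add: br_def expand)
  ultimately have "q \<star> (y * W) - p \<star> (W * y) = q \<star> (W * y) - p \<star> (y * W)"
    using h1 h2 by (simp add: x'_def z'_def qc_def)
  then have "(p + q) \<star> (y * W) = (p + q) \<star> (W * y)"
    by (simp add: expand)
  then have "y * W = W * y" using assms(4) by simp
  then show ?thesis by (simp add: qc_def W_def x'_def)
qed

text \<open>The relation \<open>y * y' - c \<star> (y' * y) = 0\<close> is bracketed with
  \<open>a\<close> using the scalar \<open>p * p\<close>; the twisted Leibniz rule leaves the mixed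
  products.\<close>

lemma lift_mixed:
  assumes "qc c y y'"
  shows "br p a y * y' + p \<star> (y * br p a y') = c \<star> (br p a y' * y + p \<star> (y' * br p a y))"
proof -
  have "br p a y * y' + p \<star> (y * br p a y') - c \<star> (br p a y' * y + p \<star> (y' * br p a y))
    = a * (y * y' - c \<star> (y' * y)) - (p * p) \<star> ((y * y' - c \<star> (y' * y)) * a)"
    by (simp add: br_def expand)
  then show ?thesis using assms by (simp add: qc_def)
qed

text \<open>Bracketing the mixed relation of \<open>lift_mixed\<close> once more with
  \<open>a\<close>, now with scalar \<open>p * q\<close>, leaves \<open>p + q\<close> times the
  relation between the two brackets.\<close>

lemma lift_qc:
  assumes yy: "qc c y y'" and h1: "qc q a (br p a y)" and h2: "qc q a (br p a y')" and "p + q \<noteq> 0"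
  shows "qc c (br p a y) (br p a y')"
proof -
  define Z Z' where "Z = br p a y" and "Z' = br p a y'"
  note m = lift_mixed[OF yy, of p a]
  define M where "M = Z * y' + p \<star> (y * Z') - c \<star> (Z' * y + p \<star> (y' * Z))"
  have "(p + q) \<star> (Z * Z') - (c * (p + q)) \<star> (Z' * Z)
    = a * M - (p * q) \<star> (M * a) - (a * Z - q \<star> (Z * a)) * y' + c \<star> ((a * Z' - q \<star> (Z' * a)) * y)
      - (p * p) \<star> (y * (a * Z' - q \<star> (Z' * a))) + (c * p * p) \<star> (y' * (a * Z - q \<star> (Z * a)))
      - q \<star> (Z * (a * y' - p \<star> (y' * a) - Z')) + (c * q) \<star> (Z' * (a * y - p \<star> (y * a) - Z))
      - p \<star> ((a * y - p \<star> (y * a) - Z) * Z') + (c * p) \<star> ((a * y' - p \<star> (y' * a) - Z') * Z)"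
    unfolding M_def by (simp add: expand)
  also have "\<dots> = 0"
    using m h1 h2 by (simp add: M_def Z_def Z'_def qc_def) (simp add: br_def)
  finally have "(p + q) \<star> (Z * Z' - c \<star> (Z' * Z)) = 0"
    by (simp add: expand)
  then show ?thesis
    using assms(4) by (simp add: qc_def Z_def Z'_def)
qed

section \<open>Commuting powers from chains of length two and three\<close>

lemma power_commute2:
  assumes y: "Z * y = a \<star> (y * Z) + y1" and y1: "qc b Z y1"
    and "a \<noteq> b" "a ^ l = 1" "b ^ l = 1"
  shows "Z ^ l * y = y * Z ^ l"
proof -
  \<comment> \<open>The coefficient \<open>h\<close> is the geometric sum of \<open>a\<close> and
    \<open>b\<close>; it is characterised by its product with \<open>a - b\<close>, which avoids
    division.\<close>
  have step: "\<exists>h. (a - b) * h = a ^ Suc m - b ^ Suc m \<and>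
      Z ^ Suc m * y = a ^ Suc m \<star> (y * Z ^ Suc m) + h \<star> (y1 * Z ^ m)" for m
  proof (induction m)
    case 0
    show ?case using y by (intro exI[of _ 1]) simp
  next
    case (Suc m)
    then obtain h where h: "(a - b) * h = a ^ Suc m - b ^ Suc m"
      and Zm: "Z ^ Suc m * y = a ^ Suc m \<star> (y * Z ^ Suc m) + h \<star> (y1 * Z ^ m)" by blast
    have "Z ^ Suc (Suc m) * y = Z * (Z ^ Suc m * y)"
      by (simp add: mult.assoc)
    also have "\<dots> = a ^ Suc m \<star> ((Z * y) * Z ^ Suc m) + h \<star> ((Z * y1) * Z ^ m)"
      unfolding Zm by (simp add: scale_mult_left scale_mult_right distrib_left mult.assoc)
    also have "\<dots> = a ^ Suc (Suc m) \<star> (y * Z ^ Suc (Suc m)) + (a ^ Suc m + b * h) \<star> (y1 * Z ^ Suc m)"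
      unfolding y qcD[OF y1]
      by (simp add: scale_mult_left scale_mult_right algebra_simps)
    finally have "Z ^ Suc (Suc m) * y
      = a ^ Suc (Suc m) \<star> (y * Z ^ Suc (Suc m)) + (a ^ Suc m + b * h) \<star> (y1 * Z ^ Suc m)" .
    moreover have "(a - b) * (a ^ Suc m + b * h) = (a - b) * a ^ Suc m + b * ((a - b) * h)"
      by (simp add: algebra_simps)
    then have "(a - b) * (a ^ Suc m + b * h) = a ^ Suc (Suc m) - b ^ Suc (Suc m)"
      unfolding h by (simp add: algebra_simps)
    ultimately show ?case by blast
  qed
  show ?thesis
  proof (cases l)
    case (Suc m)
    then show ?thesis using step[of m] assms by auto
  qed simp
qed

lemma power_commute3:
  assumes y: "Z * y = a \<star> (y * Z) + y1" and y1: "Z * y1 = b \<star> (y1 * Z) + y2" and y2: "qc c Z y2"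
    and ne: "a \<noteq> b" "b \<noteq> c" "a \<noteq> c" and roots: "a ^ l = 1" "b ^ l = 1" "c ^ l = 1"
  shows "Z ^ l * y = y * Z ^ l"
proof -
  \<comment> \<open>Here \<open>h\<close> and \<open>g\<close> are the complete homogeneous
    polynomials of degree \<open>m + 1\<close> in \<open>a, b\<close> and of degree \<open>m\<close>
    in \<open>a, b, c\<close>. The second equation says that \<open>h - (a - c) * g\<close> is the
    one of degree \<open>m + 1\<close> in \<open>b, c\<close>. At exponent \<open>l\<close> both
    vanish.\<close>
  have step: "\<exists>h g. (a - b) * h = a ^ (m + 2) - b ^ (m + 2) \<and>
      (b - c) * (h - (a - c) * g) = b ^ (m + 2) - c ^ (m + 2) \<and>
      Z ^ (m + 2) * y = a ^ (m + 2) \<star> (y * Z ^ (m + 2)) + h \<star> (y1 * Z ^ (m + 1)) + g \<star> (y2 * Z ^ m)" for m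
  proof (induction m)
    case 0
    have "Z * Z * y = Z * (a \<star> (y * Z) + y1)" by (simp only: mult.assoc y)
    also have "\<dots> = a \<star> ((Z * y) * Z) + Z * y1"
      by (simp add: scale_mult_left scale_mult_right distrib_left mult.assoc)
    also have "\<dots> = (a * a) \<star> (y * (Z * Z)) + (a + b) \<star> (y1 * Z) + y2"
      unfolding y y1 by (simp add: expand)
    finally show ?case
      by (intro exI[of _ "a + b"] exI[of _ 1]) (simp add: algebra_simps power2_eq_square)
  next
    case (Suc m)
    then obtain h g where h: "(a - b) * h = a ^ (m + 2) - b ^ (m + 2)"
      and g: "(b - c) * (h - (a - c) * g) = b ^ (m + 2) - c ^ (m + 2)"
      and Zm: "Z ^ (m + 2) * y = a ^ (m + 2) \<star> (y * Z ^ (m + 2)) + h \<star> (y1 * Z ^ (m + 1)) + g \<star> (y2 * Z ^ m)"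
      by blast
    have "Z ^ (Suc m + 2) * y = Z * (Z ^ (m + 2) * y)"
      by (simp add: mult.assoc)
    also have "\<dots> = a ^ (m + 2) \<star> ((Z * y) * Z ^ (m + 2)) + h \<star> ((Z * y1) * Z ^ (m + 1)) + g \<star> ((Z * y2) * Z ^ m)"
      unfolding Zm by (simp add: scale_mult_left scale_mult_right distrib_left mult.assoc)
    also have "\<dots> = a ^ (Suc m + 2) \<star> (y * Z ^ (Suc m + 2)) + (a ^ (m + 2) + b * h) \<star> (y1 * Z ^ (Suc m + 1))
        + (h + c * g) \<star> (y2 * Z ^ Suc m)"
      unfolding y y1 qcD[OF y2]
      by (simp add: scale_mult_left scale_mult_right algebra_simps)
    finally have "Z ^ (Suc m + 2) * y = a ^ (Suc m + 2) \<star> (y * Z ^ (Suc m + 2))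
        + (a ^ (m + 2) + b * h) \<star> (y1 * Z ^ (Suc m + 1)) + (h + c * g) \<star> (y2 * Z ^ Suc m)" .
    moreover have "(a - b) * (a ^ (m + 2) + b * h) = (a - b) * a ^ (m + 2) + b * ((a - b) * h)"
      by (simp add: algebra_simps)
    then have h': "(a - b) * (a ^ (m + 2) + b * h) = a ^ (Suc m + 2) - b ^ (Suc m + 2)"
      unfolding h by (simp add: algebra_simps)
    moreover have "(b - c) * (a ^ (m + 2) + b * h - (a - c) * (h + c * g))
        = (b - c) * (a ^ (m + 2) - (a - b) * h) + c * ((b - c) * (h - (a - c) * g))"
      by (simp add: algebra_simps)
    then have "(b - c) * (a ^ (m + 2) + b * h - (a - c) * (h + c * g)) = b ^ (Suc m + 2) - c ^ (Suc m + 2)"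
      unfolding h g by (simp add: algebra_simps)
    ultimately show ?case by blast
  qed
  show ?thesis
  proof (cases "l \<ge> 2")
    case True
    then obtain m where "l = m + 2" by (metis add.commute le_Suc_ex)
    then show ?thesis using step[of m] ne roots by auto
  next
    case False
    then have "l = 0 \<or> l = 1" by auto
    \<comment> \<open>The exponent 1 is impossible, since it would force
      \<open>a = b = 1\<close>.\<close>
    then show ?thesis using ne roots by auto
  qed
qed

text \<open>In the application \<open>b = e\<^sub>n\<^sub>-\<^sub>1\<close>, \<open>e = e\<^sub>n\<close>, \<open>c = E\<^sub>n\<^sub>-\<^sub>1\<^sub>,\<^sub>n\<close>, \<open>c' = E\<^sub>n\<^sub>-\<^sub>1\<^sub>,\<^sub>n\<^sub>'\<close>, and below
  \<open>a = E\<^sub>k\<^sub>,\<^sub>n\<^sub>-\<^sub>2\<close>, \<open>V = E\<^sub>k\<^sub>,\<^sub>n\<close>, \<open>V' = E\<^sub>k\<^sub>,\<^sub>n\<^sub>'\<close>.\<close>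

lemma rank2_relations:
  fixes r s :: 'k
  assumes c: "c = br (r * r) b e" and c': "c' = br (r * s) c e"
    and bc: "qc (s * s) b c" and c'e: "qc (s * s) c' e" and "r \<noteq> 0" "s \<noteq> 0"
  shows rank2_square: "b * c' = (s * s - r * s) \<star> (c * c) + (r * r * s * s) \<star> (c' * b)"
    and rank2_qc: "qc (s * s) c c'"
proof -
  \<comment> \<open>Each of these elements is a relation and turns out to be zero. The identities
    below write the desired relations as two-sided combinations of them, so that plain expansion
    verifies them.\<close>
  define H K N M where "H = b * c - (s * s) \<star> (c * b)" and "K = b * e - (r * r) \<star> (e * b) - c"
    and "N = c' * e - (s * s) \<star> (e * c')"
    and "M = b * c' - (s * s - r * s) \<star> (c * c) - (r * r * s * s) \<star> (c' * b)"
  have [simp]: "H = 0" "N = 0" using bc c'e by (simp_all add: H_def N_def qc_def)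
  have [simp]: "K = 0" unfolding K_def c br_def by simp
  have "M = H * e + (s * s) \<star> (c * K) - (r * s) \<star> (K * c) - (r * r * r * s) \<star> (e * H)"
    unfolding M_def c' H_def K_def by (simp add: br_def expand)
  then have [simp]: "M = 0" by simp
  then show "b * c' = (s * s - r * s) \<star> (c * c) + (r * r * s * s) \<star> (c' * b)"
    unfolding M_def by (simp only: diff_diff_eq right_minus_eq)
  have "(r * s) \<star> (c * c') - (r * s * s * s) \<star> (c' * c)
    = - (s * s) \<star> (K * c') + M * e - b * N + (r * r * s * s) \<star> (c' * K) - (r * r * s * s) \<star> (e * M)
      + (r * r * r * r * s * s) \<star> (N * b)"
    unfolding M_def N_def c' K_def by (simp add: br_def expand)
  then have "(r * s) \<star> (c * c' - (s * s) \<star> (c' * c)) = 0"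
    by (simp add: expand)
  then show "qc (s * s) c c'" using assms by (simp add: qc_def)
qed

text \<open>The crux is that \<open>c\<close> and \<open>V'\<close> commute: two computations of
  \<open>V * c'\<close> differ by \<open>r * r + r * s + s * s\<close> times their commutator, so
  \<open>nz\<close> applies. After that the bracket of \<open>V'\<close> with \<open>b\<close> is a
  multiple of \<open>X\<close>, whose twisted commutator with \<open>e\<close> cancels.\<close>

lemma rank3_relation:
  fixes r s :: 'k
  assumes c: "c = br (r * r) b e" and c': "c' = br (r * s) c e"
    and bc: "qc (s * s) b c" and c'e: "qc (s * s) c' e" and "r \<noteq> 0" "s \<noteq> 0"
    and ae: "a * e = e * a" and V: "V = br (r * r) a c" and V': "V' = br (r * r) a c'" and Vb: "V * b = b * V"
    and nz: "r * r + r * s + s * s \<noteq> 0" and t: "t * (s * s) = 1"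
  shows "qc (r * r * s * s) (br t V' b) e"
proof -
  note sq = rank2_square[OF c c' bc c'e \<open>r \<noteq> 0\<close> \<open>s \<noteq> 0\<close>] and cc' = rank2_qc[OF c c' bc c'e \<open>r \<noteq> 0\<close> \<open>s \<noteq> 0\<close>]
  have V'2: "V' = br (r * s) V e"
    unfolding V' c' V using br_assoc[OF ae] .
  have V'e: "qc (s * s) V' e"
    using qc_br_left[of 1 a e "s * s" c'] ae c'e unfolding V' by (simp add: qc_def)
  define K D N M where "K = b * e - (r * r) \<star> (e * b) - c"
    and "D = V * c - (r * s) \<star> (c * V) - b * V' + (r * r) \<star> (V' * b)"
    and "N = V' * e - (s * s) \<star> (e * V')"
    and "M = b * c' - (s * s - r * s) \<star> (c * c) - (r * r * s * s) \<star> (c' * b)"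
  have [simp]: "N = 0" "M = 0" using V'e sq by (simp_all add: N_def M_def qc_def)
  have [simp]: "K = 0" unfolding K_def c br_def by simp
  have "D = (V * b - b * V) * e + (r * r * r * s) \<star> (e * (b * V - V * b))"
    unfolding D_def c V'2 by (simp add: br_def expand)
  then have [simp]: "D = 0" using Vb by simp
  have "V * c' - ((s * s + r * s) \<star> (c * V') - (r * r + r * s) \<star> (V' * c) + (r * r * s * s) \<star> (c' * V))
    = D * e - (r * r * s * s) \<star> (e * D) + b * N + (s * s) \<star> (K * V') - (r * r) \<star> (V' * K)
      - (r * r * r * r) \<star> (N * b)"
    unfolding D_def N_def K_def c' V'2 by (simp add: br_def expand)
  then have Vc': "V * c' = (s * s + r * s) \<star> (c * V') - (r * r + r * s) \<star> (V' * c) + (r * r * s * s) \<star> (c' * V)"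
    by simp
  have mixed: "V * c' + (r * r) \<star> (c * V') = (s * s) \<star> (V' * c + (r * r) \<star> (c' * V))"
    unfolding V V' by (rule lift_mixed[OF cc'])
  have "(r * r + r * s + s * s) \<star> (c * V' - V' * c) = 0"
  proof -
    have "(r * r) \<star> (c * V') + ((r * s) \<star> (c * V') + (s * s) \<star> (c * V'))
      = (r * r) \<star> (V' * c) + ((r * s) \<star> (V' * c) + (s * s) \<star> (V' * c))"
      using mixed unfolding Vc' by (simp add: expand)
    then show ?thesis
      by (simp only: scale_left_distrib scale_right_diff_distrib right_minus_eq add.assoc)
  qed
  then have "c * V' = V' * c" using nz by simp
  then have Vc'2: "V * c' = (s * s - r * r) \<star> (V' * c) + (r * r * s * s) \<star> (c' * V)"
    unfolding Vc' by (simp add: expand)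
  define a' where "a' = br (r * r) a b"
  have V2: "V = br (r * r) a' e"
    unfolding V c a'_def using br_assoc[OF ae] .
  \<comment> \<open>\<open>X\<close> arises by bracketing the square relation \<open>M\<close> with
    \<open>a\<close>, with scalar \<open>r * r * r * r\<close>, and keeping the terms without
    \<open>b\<close>, apart from the \<open>b\<close> hidden in \<open>a'\<close>.\<close>
  define X where "X = (s * (r - s)) \<star> (a * (c * c) - (r * r * r * r) \<star> (c * c * a))
    + a' * c' - (r * r * r * r * s * s) \<star> (c' * a')"
  have "(r * r) \<star> ((s * s) \<star> (V' * b) - b * V') - X = - (a * M) + (r * r * r * r) \<star> (M * a)"
    unfolding X_def M_def V' a'_def by (simp add: br_def expand)
  then have X: "X = (r * r) \<star> ((s * s) \<star> (V' * b) - b * V')" by simp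
  \<comment> \<open>Next come the twisted commutators with \<open>e\<close>, scalar
    \<open>r * r * s * s\<close>, of the four products that make up \<open>X\<close>.\<close>
  have e1: "a * (c * c) * e - (r * r * s * s) \<star> (e * (a * (c * c))) = (s * s + r * s) \<star> (a * c' * c)"
  proof -
    have "a * (c * c) * e - (r * r * s * s) \<star> (e * (a * (c * c))) - (s * s + r * s) \<star> (a * c' * c)
      = (r * r * s * s) \<star> ((a * e - e * a) * (c * c)) + a * (c * c' - (s * s) \<star> (c' * c))"
      unfolding c' by (simp add: br_def expand)
    then show ?thesis using ae cc' by (simp add: qc_def)
  qed
  have e2: "c * c * a * e - (r * r * s * s) \<star> (e * (c * c * a)) = (s * s + r * s) \<star> (c' * c * a)"
  proof -
    have "c * c * a * e - (r * r * s * s) \<star> (e * (c * c * a)) - (s * s + r * s) \<star> (c' * c * a)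
      = c * c * (a * e - e * a) + (c * c' - (s * s) \<star> (c' * c)) * a"
      unfolding c' by (simp add: br_def expand)
    then show ?thesis using ae cc' by (simp add: qc_def)
  qed
  have e3: "a' * c' * e - (r * r * s * s) \<star> (e * (a' * c')) = (s * s) \<star> (V * c')"
  proof -
    have "a' * c' * e - (r * r * s * s) \<star> (e * (a' * c')) - (s * s) \<star> (V * c')
      = a' * (c' * e - (s * s) \<star> (e * c'))"
      unfolding V2 by (simp add: br_def expand)
    then show ?thesis using c'e by (simp add: qc_def)
  qed
  have e4: "c' * a' * e - (r * r * s * s) \<star> (e * (c' * a')) = c' * V"
  proof -
    have "c' * a' * e - (r * r * s * s) \<star> (e * (c' * a')) - c' * V
      = (r * r) \<star> ((c' * e - (s * s) \<star> (e * c')) * a')"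
      unfolding V2 by (simp add: br_def expand)
    then show ?thesis using c'e by (simp add: qc_def)
  qed
  have e5: "a * c' * c - (r * r * r * r) \<star> (c' * c * a) = V' * c + (r * r) \<star> (c' * V)"
    unfolding V V' by (simp add: br_def expand)
  have "X * e - (r * r * s * s) \<star> (e * X)
    = (s * (r - s)) \<star> ((a * (c * c) * e - (r * r * s * s) \<star> (e * (a * (c * c))))
        - (r * r * r * r) \<star> (c * c * a * e - (r * r * s * s) \<star> (e * (c * c * a))))
      + (a' * c' * e - (r * r * s * s) \<star> (e * (a' * c')))
      - (r * r * r * r * s * s) \<star> (c' * a' * e - (r * r * s * s) \<star> (e * (c' * a')))"
    unfolding X_def by (simp add: expand)
  also have "\<dots> = (s * (r - s) * (s * s + r * s)) \<star> (a * c' * c - (r * r * r * r) \<star> (c' * c * a))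
      + (s * s) \<star> (V * c') - (r * r * r * r * s * s) \<star> (c' * V)"
    unfolding e1 e2 e3 e4 by (simp add: expand)
  also have "\<dots> = 0"
    unfolding e5 Vc'2 by (simp add: expand)
  finally have "qc (r * r * s * s) X e" by (simp add: qc_def)
  then have "qc (r * r * s * s) ((t * inverse (r * r)) \<star> X) e" by (rule qc_scale_left)
  moreover have "(t * inverse (r * r)) \<star> X = (t * inverse (r * r) * (r * r)) \<star> ((s * s) \<star> (V' * b) - b * V')"
    unfolding X by simp
  moreover have "t * inverse (r * r) * (r * r) = t" using \<open>r \<noteq> 0\<close> by (simp add: field_simps)
  moreover have "t \<star> ((s * s) \<star> (V' * b) - b * V') = br t V' b"
    using t by (simp add: br_def scale_right_diff_distrib)
  ultimately show ?thesis by (simp only:)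
qed

lemma qc_1_right_cancel:
  assumes "qc 1 X (c \<star> (z * v))" "qc 1 X v" "c \<noteq> 0" "v * v' = 1"
  shows "qc 1 X z"
proof -
  have "qc 1 X (z * v)" using qc_scale[OF assms(1), of "inverse c"] assms(3) by simp
  then have "X * z * v = z * v * X" by (simp add: qc_1 mult.assoc)
  also have "\<dots> = z * X * v" using assms(2) by (simp add: qc_1 mult.assoc)
  finally have "X * z * (v * v') = z * X * (v * v')" by (simp add: mult.assoc[symmetric])
  then show ?thesis using assms(4) by (simp add: qc_1)
qed

lemma power_commute_br2:
  assumes "br a Z y = y1" "qc b Z y1" "a \<noteq> b" "a ^ l = 1" "b ^ l = 1"
  shows "qc 1 (Z ^ l) y"
  using power_commute2[of Z y a y1 b l] assms by (auto simp: br_def qc_1)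

lemma power_commute_br3:
  assumes "br a Z y = y1" "br b Z y1 = y2" "qc c Z y2" "a \<noteq> b" "b \<noteq> c" "a \<noteq> c"
    "a ^ l = 1" "b ^ l = 1" "c ^ l = 1"
  shows "qc 1 (Z ^ l) y"
  using power_commute3[of Z y a y1 b y2 c l] assms by (auto simp: br_def qc_1)

end

section \<open>Relations between root vectors\<close>

text \<open>The adjoint action of a skew-primitive \<open>x\<close> with coproduct \<open>x \<otimes> 1 + v \<otimes> x\<close>, where \<open>v'\<close> is
  the inverse of \<open>v\<close>.\<close>
definition ad :: "'a::ring_1 \<Rightarrow> 'a \<Rightarrow> 'a \<Rightarrow> 'a \<Rightarrow> 'a" where
  "ad x v v' b = x * b - v * b * v' * x"

lemma (in scalar_algebra) ad_eq_br:
  assumes "qc c v b" "v * v' = 1"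
  shows "ad x v v' b = br c x b"
proof -
  have "v * b * v' = c \<star> (b * (v * v'))" by (simp add: qcD[OF assms(1)] expand)
  then show ?thesis using assms(2) by (simp add: ad_def br_def expand)
qed

text \<open>This form of the presentation fits two situations: the quotient ring, where
  \<open>E\<close> and \<open>E'\<close> are the positive root vectors, and its opposite with
  \<open>e\<close> and \<open>f\<close>, \<open>w\<close> and \<open>w'\<close>, \<open>r\<close>
  and \<open>s\<close> exchanged, where they are the negative ones.\<close>

locale two_parameter_so = scalar_algebra scale
  for scale :: "'k::field \<Rightarrow> 'a::ring_1 \<Rightarrow> 'a" (infixr "\<star>" 75) +
  fixes n l :: nat and r s :: 'k and e f w w' wi wi' :: "nat \<Rightarrow> 'a" and E E' :: "nat \<Rightarrow> nat \<Rightarrow> 'a"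
  assumes n_ge_2: "2 \<le> n"
    and r_root: "r ^ l = 1" and s_root: "s ^ l = 1"
    and r_nz: "r \<noteq> 0" and s_nz: "s \<noteq> 0"
    and cubes_ne: "r ^ 3 \<noteq> s ^ 3" and fourth_ne: "r ^ 4 \<noteq> s ^ 4"
    and w_inverse: "i \<in> {1..n} \<Longrightarrow> w i * wi i = 1" "i \<in> {1..n} \<Longrightarrow> w' i * wi' i = 1"
    and w_w: "i \<in> {1..n} \<Longrightarrow> j \<in> {1..n} \<Longrightarrow> w i * w j = w j * w i"
    and w_w': "i \<in> {1..n} \<Longrightarrow> j \<in> {1..n} \<Longrightarrow> w i * w' j = w' j * w i"
    and w_e: "i \<in> {1..n} \<Longrightarrow> j \<in> {1..n} \<Longrightarrow> qc (pairing n r s i j) (w j) (e i)"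
    and w_f: "i \<in> {1..n} \<Longrightarrow> j \<in> {1..n} \<Longrightarrow> qc (inverse (pairing n r s i j)) (w j) (f i)"
    and w'_e: "i \<in> {1..n} \<Longrightarrow> j \<in> {1..n} \<Longrightarrow> qc (inverse (pairing n r s j i)) (w' j) (e i)"
    and w'_f: "i \<in> {1..n} \<Longrightarrow> j \<in> {1..n} \<Longrightarrow> qc (pairing n r s j i) (w' j) (f i)"
    and e_f: "i \<in> {1..n} \<Longrightarrow> j \<in> {1..n} \<Longrightarrow> br 1 (e i) (f j)
      = (if i = j then inverse (rr n r i - rr n s i) \<star> (w i - w' i) else 0)"
    and serre: "i \<in> {1..n} \<Longrightarrow> j \<in> {1..n} \<Longrightarrow> i \<noteq> j \<Longrightarrow>
      (ad (e i) (w i) (wi i) ^^ nat (1 - cartan n i j)) (e j) = 0"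
    and E_refl: "j \<in> {1..n} \<Longrightarrow> E j j = e j"
    and E_rec: "1 \<le> k \<Longrightarrow> k < j \<Longrightarrow> j \<le> n \<Longrightarrow> E k j = br (r * r) (e k) (E (Suc k) j)"
    and E'_n: "1 \<le> k \<Longrightarrow> k < n \<Longrightarrow> E' k n = br (r * s) (E k n) (e n)"
    and E'_rec: "1 \<le> k \<Longrightarrow> k < j \<Longrightarrow> j < n \<Longrightarrow> E' k j = br (inverse (s * s)) (E' k (Suc j)) (e j)"
begin

section \<open>Nonvanishing scalars and values of the pairing\<close>

definition RR where "RR = r * r"
definition SS where "SS = s * s"

lemma RR_nz [simp]: "RR \<noteq> 0" and SS_nz [simp]: "SS \<noteq> 0"
  using r_nz s_nz by (simp_all add: RR_def SS_def)

lemma r_ne_s: "r \<noteq> s"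
  using cubes_ne by auto

lemma squares_ne: "RR \<noteq> SS"
proof
  assume "RR = SS"
  then have "RR * RR = SS * SS" by simp
  then show False using fourth_ne by (simp add: RR_def SS_def numeral_eq_Suc mult.assoc)
qed

lemma RR_plus_SS: "RR + SS \<noteq> 0"
proof
  assume "RR + SS = 0"
  then have "(RR + SS) * (RR - SS) = 0" by simp
  then show False using fourth_ne by (simp add: RR_def SS_def numeral_eq_Suc algebra_simps)
qed

lemma cyclotomic3_nz: "r * r + r * s + s * s \<noteq> 0"
proof
  assume "r * r + r * s + s * s = 0"
  then have "(r * r + r * s + s * s) * (r - s) = 0" by simp
  then show False using cubes_ne by (simp add: numeral_eq_Suc algebra_simps)
qed

lemma RR_root [simp]: "RR ^ l = 1" and SS_root [simp]: "SS ^ l = 1" and rs_root [simp]: "(r * s) ^ l = 1"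
  using r_root s_root by (simp_all add: RR_def SS_def power_mult_distrib)

lemma pairing_same: "i < n \<Longrightarrow> pairing n r s i i = RR * inverse SS"
  and pairing_n: "pairing n r s n n = r * inverse s"
  and pairing_up: "pairing n r s i (Suc i) = inverse RR"
  and pairing_down: "pairing n r s (Suc i) i = SS"
  and pairing_far: "i + 1 < j \<or> j + 1 < i \<Longrightarrow> pairing n r s i j = 1"
  by (auto simp: pairing_def RR_def SS_def power2_eq_square)

lemma pairing_root [simp]: "pairing n r s i j ^ l = 1"
  using r_root s_root RR_root SS_root
  by (auto simp: pairing_def RR_def SS_def power2_eq_square power_mult_distrib power_inverse)

section \<open>Serre relations as q-commutation\<close>

text \<open>The adjoint action is a bracket whose scalar is the weight of its argument under
  \<open>w i\<close>. The second claim passes the weight on to the result, so that iterated adjoint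
  actions become nested brackets.\<close>

lemma ad_e_br:
  assumes "i \<in> {1..n}" "qc c (w i) b"
  shows "ad (e i) (w i) (wi i) b = br c (e i) b"
    and "qc (pairing n r s i i * c) (w i) (br t (e i) b)"
  using assms ad_eq_br[of c "w i" b "wi i" "e i"] w_inverse(1)[of i] qc_br[OF w_e[of i i] assms(2)] by auto

lemma e_far:
  assumes "i \<in> {1..n}" "j \<in> {1..n}" "i + 1 < j"
  shows "qc 1 (e i) (e j)"
proof -
  have "cartan n i j = 0" using assms by (auto simp: cartan_def)
  then have "ad (e i) (w i) (wi i) (e j) = 0" using serre[of i j] assms by simp
  then show ?thesis
    using ad_e_br(1)[OF _ w_e[of j i]] assms by (simp add: pairing_far br_eq_0_iff)
qed

lemma serre_2:
  assumes "i \<in> {1..n}" "j \<in> {1..n}" "cartan n i j = - 1"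
  shows "qc (pairing n r s i i * pairing n r s j i) (e i) (br (pairing n r s j i) (e i) (e j))"
proof -
  have "i \<noteq> j" using assms by (auto simp: cartan_def)
  then have "ad (e i) (w i) (wi i) (ad (e i) (w i) (wi i) (e j)) = 0"
    using serre[of i j] assms by (simp add: numeral_2_eq_2)
  moreover note a = ad_e_br[OF assms(1) w_e[OF assms(2,1)]]
  moreover note ad_e_br(1)[OF assms(1) a(2)]
  ultimately show ?thesis by (simp add: br_eq_0_iff)
qed

lemma serre_up:
  assumes "1 \<le> i" "i < n"
  shows "qc (r * r) (e i) (br (s * s) (e i) (e (Suc i)))"
proof -
  have "cartan n i (Suc i) = - 1" using assms by (auto simp: cartan_def)
  from serre_2[OF _ _ this] have "qc (RR * inverse SS * SS) (e i) (br SS (e i) (e (Suc i)))"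
    using assms by (simp add: pairing_same pairing_down)
  moreover have "RR * inverse SS * SS = RR" by (simp add: field_simps)
  ultimately show ?thesis by (simp only: RR_def SS_def)
qed

lemma serre_down:
  assumes "1 \<le> i" "Suc i < n"
  shows "qc (inverse (s * s)) (e (Suc i)) (br (inverse (r * r)) (e (Suc i)) (e i))"
proof -
  have "cartan n (Suc i) i = - 1" using assms by (auto simp: cartan_def)
  from serre_2[OF _ _ this] have "qc (RR * inverse SS * inverse RR) (e (Suc i)) (br (inverse RR) (e (Suc i)) (e i))"
    using assms by (simp add: pairing_same pairing_up)
  moreover have "RR * inverse SS * inverse RR = inverse SS" by (simp add: field_simps)
  ultimately show ?thesis by (simp only: RR_def SS_def)
qed

text \<open>The Cartan entry -2 gives three nested brackets; each application of \<open>e n\<close>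
  multiplies the scalar by \<open>r * inverse s\<close>.\<close>

lemma serre_last: "qc (inverse (s * s)) (e n) (br (inverse (r * s)) (e n) (br (inverse (r * r)) (e n) (e (n - 1))))"
proof -
  define m where "m = n - 1"
  have m: "n = Suc m" "m \<in> {1..n}" "n \<in> {1..n}" using n_ge_2 by (auto simp: m_def)
  define p q where "p = pairing n r s m n" and "q = pairing n r s n n"
  have pq: "p = inverse (r * r)" "q * p = inverse (r * s)" "q * (q * p) = inverse (s * s)"
  proof -
    have pq': "p = inverse RR" "q = r * inverse s" using m(1) pairing_up[of m] pairing_n by (simp_all add: p_def q_def)
    show "p = inverse (r * r)" "q * p = inverse (r * s)" "q * (q * p) = inverse (s * s)"
      unfolding pq' using r_nz s_nz by (simp_all add: RR_def field_simps)
  qed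
  have "cartan n n m = - 2" using m by (auto simp: cartan_def)
  then have "ad (e n) (w n) (wi n) (ad (e n) (w n) (wi n) (ad (e n) (w n) (wi n) (e m))) = 0"
    using serre[of n m] m(1,2) by (simp add: numeral_3_eq_3)
  moreover note a = ad_e_br[OF m(3) w_e[OF m(2,3)], folded p_def q_def]
  moreover note b = ad_e_br[OF m(3) a(2), folded p_def q_def]
  moreover note ad_e_br(1)[OF m(3) b(2)]
  ultimately have "br (q * (q * p)) (e n) (br (q * p) (e n) (br p (e n) (e m))) = 0"
    by simp
  then show ?thesis unfolding pq(3) unfolding pq(2) unfolding pq(1) m_def by (simp add: br_eq_0_iff)
qed

lemma e_comm:
  assumes "i \<in> {1..n}" "j \<in> {1..n}" "i + 1 < j \<or> j + 1 < i"
  shows "qc 1 (e i) (e j)"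
  using assms e_far[of i j] qc_1_sym[OF e_far[of j i]] by auto

section \<open>Unprimed root vectors and the letters \<open>e i\<close>\<close>

lemma E_up: "1 \<le> k \<Longrightarrow> k < n \<Longrightarrow> E k (Suc k) = br RR (e k) (e (Suc k))"
  by (simp add: E_rec E_refl RR_def)

lemma E_left: "1 \<le> k \<Longrightarrow> k < j \<Longrightarrow> j \<le> n \<Longrightarrow> E k j = br RR (e k) (E (Suc k) j)"
  by (simp add: E_rec RR_def)

text \<open>The defining recursion adds letters on the left. Since \<open>e m\<close> and
  \<open>e (Suc j)\<close> commute for \<open>m < j\<close>, \<open>br_assoc\<close> lets the last
  letter be split off instead.\<close>

lemma E_right:
  assumes "1 \<le> k" "k \<le> j" "j < n"
  shows "E k (Suc j) = br RR (E k j) (e (Suc j))"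
  using assms(2)
proof (induction rule: inc_induct)
  case base
  then show ?case using assms by (simp add: E_up E_refl)
next
  case (step m)
  have "E m (Suc j) = br RR (e m) (br RR (E (Suc m) j) (e (Suc j)))"
    using step assms by (simp add: E_left[of m "Suc j"])
  also have "\<dots> = br RR (br RR (e m) (E (Suc m) j)) (e (Suc j))"
    using e_comm[of m "Suc j"] step assms by (intro br_assoc) (simp add: qc_1)
  also have "br RR (e m) (E (Suc m) j) = E m j"
    using step assms by (simp add: E_left[of m j])
  finally show ?case .
qed

lemma E'_step: "1 \<le> k \<Longrightarrow> k < j \<Longrightarrow> j < n \<Longrightarrow> E' k j = br (inverse SS) (E' k (Suc j)) (e j)"
  by (simp add: E'_rec SS_def)

lemma E'_left:
  assumes "1 \<le> k" "Suc k < j" "j \<le> n"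
  shows "E' k j = br RR (e k) (E' (Suc k) j)"
  using assms(3)
proof (induction rule: inc_induct)
  case base
  have "E' k n = br (r * s) (br RR (e k) (E (Suc k) n)) (e n)"
    using assms by (simp add: E'_n E_left[of k n])
  also have "\<dots> = br RR (e k) (br (r * s) (E (Suc k) n) (e n))"
    using e_comm[of k n] assms by (intro br_assoc[symmetric]) (simp add: qc_1)
  finally show ?case using assms by (simp add: E'_n)
next
  case (step m)
  have "E' k m = br (inverse SS) (br RR (e k) (E' (Suc k) (Suc m))) (e m)"
    using step assms by (simp add: E'_step[of k m])
  also have "\<dots> = br RR (e k) (br (inverse SS) (E' (Suc k) (Suc m)) (e m))"
    using e_comm[of k m] step assms by (intro br_assoc[symmetric]) (simp add: qc_1)
  finally show ?case using step assms by (simp add: E'_step[of "Suc k" m])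
qed

lemma E_far:
  assumes "1 \<le> k" "k \<le> j" "j \<le> n" "i \<in> {1..n}" "i + 1 < k \<or> j + 1 < i"
  shows "qc 1 (e i) (E k j)"
  using assms(2)
proof (induction rule: inc_induct)
  case base
  then show ?case using assms e_comm[of i j] by (auto simp: E_refl)
next
  case (step m)
  then show ?case using assms e_comm[of i m] by (auto simp: E_left[of m j] intro!: qc_br_1)
qed

text \<open>For two letters this is the Serre relation with its scalars swapped; all further letters
  commute with \<open>e k\<close>.\<close>

lemma E_first:
  assumes "1 \<le> k" "Suc k \<le> j" "j \<le> n"
  shows "qc SS (e k) (E k j)"
  using assms(2)
proof (induction rule: dec_induct)
  case base
  show ?case using qc_swap_br[OF serre_up[of k]] assms by (simp add: E_up RR_def SS_def)
next
  case (step m)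
  then show ?case using assms e_comm[of k "Suc m"] by (auto simp: E_right[of k m] intro!: qc_br_2)
qed

lemma E_last:
  assumes "1 \<le> k" "k \<le> j" "Suc j < n"
  shows "qc SS (E k (Suc j)) (e (Suc j))"
  using assms(2)
proof (induction rule: inc_induct)
  case base
  have "E j (Suc j) = - RR \<star> br (inverse RR) (e (Suc j)) (e j)"
    using assms by (simp add: E_up br_inverse[of RR "inverse RR"])
  then have "qc (inverse SS) (e (Suc j)) (E j (Suc j))"
    using serre_down[of j] assms by (simp add: RR_def SS_def qc_scale qc_uminus)
  then show ?case by (rule qc_sym) simp
next
  case (step m)
  then show ?case using assms e_comm[of m "Suc j"]
    by (auto simp: E_left[of m "Suc j"] intro!: qc_br_left_1)
qed

text \<open>The three letters around \<open>e i\<close> are an instance of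
  \<open>rank3_middle_commutes\<close>, with \<open>RR + SS\<close> nonzero. The letters added on
  either side commute with \<open>e i\<close>.\<close>

lemma E_mid:
  assumes "1 \<le> k" "k < i" "i < j" "j \<le> n"
  shows "qc 1 (e i) (E k j)"
proof -
  obtain m where i: "i = Suc m" using assms by (cases i) auto
  have "qc 1 (e i) (E m (Suc i))"
  proof -
    have "qc 1 (e i) (br RR (br RR (e m) (e i)) (e (Suc i)))"
    proof (rule rank3_middle_commutes[where q = SS])
      show "e m * e (Suc i) = e (Suc i) * e m" using e_comm[of m "Suc i"] assms i by (simp add: qc_1)
      show "qc SS (br RR (e m) (e i)) (e i)" using E_last[of m m] assms i by (simp add: E_up)
      show "qc SS (e i) (br RR (e i) (e (Suc i)))" using E_first[of i "Suc i"] assms by (simp add: E_up)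
    qed (rule RR_plus_SS)
    then show ?thesis using assms i E_right[of m i] E_up[of m] by simp
  qed
  then have m: "qc 1 (e i) (E m j)"
  proof -
    have "Suc i \<le> j" using assms by simp
    then show ?thesis
    proof (induction rule: dec_induct)
      case base
      show ?case by fact
    next
      case (step q)
      then show ?case using assms i e_comm[of i "Suc q"] by (auto simp: E_right[of m q] intro!: qc_br_2)
    qed
  qed
  have "k \<le> m" using assms i by simp
  then show ?thesis
  proof (induction rule: inc_induct)
    case base
    show ?case by fact
  next
    case (step q)
    then show ?case using assms i e_comm[of i q] by (auto simp: E_left[of q j] intro!: qc_br_1)
  qed
qed

section \<open>Primed root vectors and the letters \<open>e i\<close>\<close>

text \<open>In row \<open>n - 1\<close> this is \<open>serre_last\<close> with both inner brackets
  reversed by \<open>br_inverse\<close>; the earlier letters commute with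
  \<open>e n\<close>.\<close>

lemma E'_n_last:
  assumes "1 \<le> k" "k < n"
  shows "qc SS (E' k n) (e n)"
proof -
  have "k \<le> n - 1" using assms by simp
  then show ?thesis
  proof (induction rule: inc_induct)
    case base
    have "E' (n - 1) n = br (r * s) (br RR (e (n - 1)) (e n)) (e n)"
      using n_ge_2 E_up[of "n - 1"] by (simp add: E'_n)
    also have "\<dots> = - (r * s) \<star> br (inverse (r * s)) (e n) (br RR (e (n - 1)) (e n))"
      using r_nz s_nz by (intro br_inverse) (simp add: field_simps)
    also have "br RR (e (n - 1)) (e n) = - RR \<star> br (inverse RR) (e n) (e (n - 1))"
      by (intro br_inverse) simp
    finally have "qc (inverse SS) (e n) (E' (n - 1) n)"
      using serre_last by (simp add: RR_def SS_def br_scale br_uminus qc_scale qc_uminus)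
    then show ?case by (rule qc_sym) simp
  next
    case (step m)
    then show ?case using assms e_comm[of m n] by (auto simp: E'_left[of m n] intro!: qc_br_left_1)
  qed
qed

lemma E'_before:
  assumes "1 \<le> k" "k < i" "Suc i < j" "j \<le> n"
  shows "qc 1 (e i) (E' k j)"
  using assms(4)
proof (induction rule: inc_induct)
  case base
  show ?case using E_mid[of k i n] e_comm[of i n] assms by (auto simp: E'_n intro!: qc_br_1)
next
  case (step m)
  then show ?case using e_comm[of i m] assms by (auto simp: E'_step[of k m] intro!: qc_br_1)
qed

text \<open>\<open>pv k j\<close> is the predecessor of \<open>E' k j\<close> in row \<open>k\<close>, and \<open>pc j\<close> the scalar of the bracket
  that leads from it to \<open>E' k j\<close>.\<close>

definition pv where "pv k j = (if j = n then E k n else E' k (Suc j))"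
definition pc where "pc j = (if j = n then r * s else inverse SS)"

lemma E'_pv: "1 \<le> k \<Longrightarrow> k < j \<Longrightarrow> j \<le> n \<Longrightarrow> E' k j = br (pc j) (pv k j) (e j)"
  by (auto simp: pv_def pc_def E'_n E'_step[of k j])

lemma pv_comm: "1 \<le> k \<Longrightarrow> k < j \<Longrightarrow> Suc j \<le> n \<Longrightarrow> qc 1 (e j) (pv k (Suc j))"
  using E_mid[of k j n] E'_before[of k j "Suc (Suc j)"] by (auto simp: pv_def)

text \<open>Since \<open>e j\<close> commutes with the predecessor of \<open>E' k (Suc j)\<close>,
  the Serre relation between \<open>e j\<close> and \<open>e (Suc j)\<close> carries over to
  \<open>E' k (Suc j)\<close>.\<close>

lemma E'_last:
  assumes "1 \<le> k" "k < j" "j < n"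
  shows "qc (inverse RR) (E' k j) (e j)"
proof -
  have "qc RR (e j) (br SS (e j) (br (pc (Suc j)) (pv k (Suc j)) (e (Suc j))))"
    using assms br_left_comm[OF pv_comm[of k j]] pv_comm[of k j] serre_up[of j]
    by (simp add: RR_def SS_def qc_br_1)
  then have "qc RR (e j) (br SS (e j) (E' k (Suc j)))"
    using assms by (simp add: E'_pv[of k "Suc j"])
  then have "qc RR (e j) (- (inverse SS) \<star> br SS (e j) (E' k (Suc j)))"
    by (rule qc_scale)
  also have "- (inverse SS) \<star> br SS (e j) (E' k (Suc j)) = E' k j"
    using assms by (simp add: E'_step[of k j] br_inverse[of "inverse SS" SS])
  finally show ?thesis by (rule qc_sym) simp
qed

text \<open>Again \<open>rank3_middle_commutes\<close>, now for \<open>E' k (Suc i)\<close>,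
  \<open>e i\<close> and \<open>e (i - 1)\<close>. The letter \<open>e n\<close> behaves differently
  and is treated in \<open>E'_after_n\<close>.\<close>

lemma E'_after:
  assumes "1 \<le> k" "k < j" "j < i" "i < n"
  shows "qc 1 (e i) (E' k j)"
proof -
  obtain m where i: "i = Suc m" using assms by (cases i) auto
  have "j \<le> m" using assms i by simp
  then show ?thesis
  proof (induction rule: inc_induct)
    case base
    have "qc 1 (e i) (br (inverse SS) (br (inverse SS) (E' k (Suc i)) (e i)) (e m))"
    proof (rule rank3_middle_commutes[where q = "inverse RR"])
      show "E' k (Suc i) * e m = e m * E' k (Suc i)"
        using E'_before[of k m "Suc i"] assms i by (simp add: qc_1)
      show "qc (inverse RR) (br (inverse SS) (E' k (Suc i)) (e i)) (e i)"
        using E'_last[of k i] assms by (simp add: E'_step[of k i])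
      show "qc (inverse RR) (e i) (br (inverse SS) (e i) (e m))"
        using qc_swap_br[OF serre_down[of m]] assms i by (simp add: RR_def SS_def)
      have "inverse SS + inverse RR = (RR + SS) * (inverse RR * inverse SS)"
        by (simp add: field_simps)
      then show "inverse SS + inverse RR \<noteq> 0" using RR_plus_SS by simp
    qed
    then show ?case using assms i E'_step[of k m] E'_step[of k i] by simp
  next
    case (step q)
    then show ?case using assms i e_comm[of i q] by (auto simp: E'_step[of k q] intro!: qc_br_2)
  qed
qed

text \<open>Cuts off the last two letters, which puts \<open>E k n\<close> into the form of
  \<open>V\<close> in \<open>rank3_relation\<close>.\<close>

lemma E_split:
  assumes "1 \<le> k" "k \<le> m" "n = Suc (Suc m)"
  shows "E k n = br RR (E k m) (E (Suc m) n)"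
proof -
  have "E k n = br RR (br RR (E k m) (e (Suc m))) (e n)"
    using assms by (simp add: E_right[of k m] E_right[of k "Suc m"])
  also have "\<dots> = br RR (E k m) (br RR (e (Suc m)) (e n))"
    using E_far[of k m n] assms by (intro br_assoc[symmetric]) (simp add: qc_1)
  finally show ?thesis using assms by (simp add: E_up)
qed

lemma rank2_hyps:
  assumes "n = Suc m"
  shows "E m n = br (r * r) (e m) (e n)" "E' m n = br (r * s) (E m n) (e n)"
    "qc (s * s) (e m) (E m n)" "qc (s * s) (E' m n) (e n)"
  using assms n_ge_2 E_up[of m] E_first[of m n] E'_n_last[of m] E'_n[of m] by (simp_all add: RR_def SS_def)

text \<open>The case \<open>j = n - 1\<close> is \<open>rank3_relation\<close>; every further letter
  \<open>e q\<close> has \<open>q < n - 1\<close> and commutes with \<open>e n\<close>.\<close>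

lemma E'_after_n:
  assumes "1 \<le> k" "k < j" "j < n"
  shows "qc (RR * SS) (E' k j) (e n)"
proof -
  define m where "m = n - 2"
  have n: "n = Suc (Suc m)" and m: "k \<le> m" "k < Suc m" "m < n" "Suc m < n" "Suc m \<le> n" "Suc m + 1 = n"
    using assms by (simp_all add: m_def)
  have "j \<le> Suc m" using assms n by simp
  then show ?thesis
  proof (induction rule: inc_induct)
    case base
    have ae: "E k m * e n = e n * E k m" using E_far[of k m n] assms m by (simp add: qc_1)
    have V: "E k n = br (r * r) (E k m) (E (Suc m) n)"
      using E_split[OF _ _ n] assms m by (simp add: RR_def)
    have V': "E' k n = br (r * r) (E k m) (E' (Suc m) n)"
      using assms m V br_assoc[OF ae, of "r * r" "r * s" "E (Suc m) n"] E'_n[of k] E'_n[of "Suc m"] by simp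
    have Vb: "E k n * e (Suc m) = e (Suc m) * E k n"
      using E_mid[of k "Suc m" n] assms m by (simp add: qc_1)
    have "qc (r * r * s * s) (br (inverse (s * s)) (E' k n) (e (Suc m))) (e n)"
      by (rule rank3_relation[OF rank2_hyps[OF n] r_nz s_nz ae V V' Vb cyclotomic3_nz]) (simp add: s_nz field_simps)
    moreover have "E' k (Suc m) = br (inverse (s * s)) (E' k n) (e (Suc m))"
      using E'_rec[of k "Suc m"] assms m n by simp
    ultimately show ?case by (simp add: RR_def SS_def mult.assoc)
  next
    case (step q)
    then show ?case using assms m e_comm[of q n] by (auto simp: E'_step[of k q] intro!: qc_br_left_2)
  qed
qed

section \<open>Neighbours in a row\<close>

lemma adjacent_E:
  assumes "1 \<le> k" "k \<le> j" "j < n"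
  shows "qc SS (E k j) (E k (Suc j))"
  using assms(2)
proof (induction rule: dec_induct)
  case base
  show ?case using E_first[of k "Suc k"] assms by (simp add: E_refl)
next
  case (step m)
  have "qc SS (E k m) (E k (Suc (Suc m)))"
    using step assms E_far[of k m "Suc (Suc m)"] qc_1_sym[of "e (Suc (Suc m))" "E k m"]
    by (auto simp: E_right[of k "Suc m"] intro!: qc_br_2)
  moreover have "qc 1 (e (Suc m)) (E k (Suc (Suc m)))"
    using step assms E_mid[of k "Suc m" "Suc (Suc m)"] by simp
  moreover have "E k (Suc m) = br RR (E k m) (e (Suc m))" using step assms by (simp add: E_right[of k m])
  ultimately show ?case by (simp add: qc_br_left_2)
qed

text \<open>The induction runs over the row: starting from \<open>rank2_qc\<close>, the letter
  \<open>e q\<close> is prefixed to both vectors at once by \<open>lift_qc\<close>.\<close>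

lemma adjacent_E_E':
  assumes "1 \<le> k" "k < n"
  shows "qc SS (E k n) (E' k n)"
proof -
  define m where "m = n - 1"
  have n: "Suc m = n" using assms by (simp add: m_def)
  have "k \<le> m" using assms n by simp
  then show ?thesis
  proof (induction rule: inc_induct)
    case base
    show ?case using rank2_qc[OF rank2_hyps[OF n[symmetric]] r_nz s_nz] by (simp add: SS_def)
  next
    case (step q)
    have q: "E q n = br RR (e q) (E (Suc q) n)" "E' q n = br RR (e q) (E' (Suc q) n)"
      using step assms n by (simp_all add: E_left[of q n] E'_left[of q n])
    have "qc SS (e q) (E q n)" using E_first[of q n] step assms n by simp
    moreover from this have "qc SS (e q) (E' q n)"
      using e_comm[of q n] step assms n by (auto simp: E'_n intro!: qc_br_2)
    ultimately show ?case
      using lift_qc[OF step.IH, of SS "e q" RR] RR_plus_SS by (simp add: q)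
  qed
qed

text \<open>For \<open>j = n - 1\<close> the factor \<open>E k n\<close> of \<open>E' k n\<close>
  contributes \<open>SS\<close> and \<open>e n\<close> contributes \<open>inverse (RR * SS)\<close>.
  Below that, the newly split off letter \<open>e (Suc q)\<close> commutes with
  \<open>E' k q\<close>.\<close>

lemma adjacent_E':
  assumes "1 \<le> k" "k < j" "j < n"
  shows "qc (inverse RR) (E' k (Suc j)) (E' k j)"
proof -
  define m where "m = n - 1"
  have n: "Suc m = n" using assms by (simp add: m_def)
  have "j \<le> m" using assms n by simp
  then show ?thesis
  proof (induction rule: inc_induct)
    case base
    have km: "k < m" using assms n by simp
    have E: "E' k m = br (inverse SS) (E' k n) (e m)" using km assms n by (simp add: E'_step[of k m])
    have "qc SS (E k n) (E' k m)"
      unfolding E using adjacent_E_E'[of k] qc_1_sym[OF E_mid[of k m n]] km assms n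
      by (intro qc_br_2) simp_all
    moreover have "qc (inverse (RR * SS)) (e n) (E' k m)"
      using km assms n by (intro qc_sym[OF E'_after_n[of k m]]) (auto simp: field_simps)
    ultimately have "qc (SS * inverse (RR * SS)) (E' k n) (E' k m)"
      using qc_br_left[of SS "E k n" "E' k m" "inverse (RR * SS)" "e n"] assms by (simp add: E'_n)
    then show ?case using n by (simp add: field_simps)
  next
    case (step q)
    have q: "k < q" "Suc q < n" using step assms n by auto
    have E: "E' k q = br (inverse SS) (E' k (Suc q)) (e q)" using q assms by (simp add: E'_step[of k q])
    have "qc (inverse RR) (E' k (Suc (Suc q))) (E' k q)"
      unfolding E using step.IH qc_1_sym[OF E'_before[of k q "Suc (Suc q)"]] q assms
      by (intro qc_br_2) simp_all
    moreover have "qc 1 (e (Suc q)) (E' k q)" using E'_after[of k q "Suc q"] q assms by simp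
    moreover have "E' k (Suc q) = br (inverse SS) (E' k (Suc (Suc q))) (e (Suc q))"
      using q assms by (simp add: E'_step[of k "Suc q"])
    ultimately show ?case by (simp add: qc_br_left_2)
  qed
qed

section \<open>Weights and commutators with the \<open>f\<^sub>i\<close>\<close>

lemma w_e_same: "i \<in> {1..n} \<Longrightarrow> i < n \<Longrightarrow> qc (RR * inverse SS) (w i) (e i)"
    "i \<in> {1..n} \<Longrightarrow> i < n \<Longrightarrow> qc (SS * inverse RR) (w' i) (e i)"
  using w_e[of i i] w'_e[of i i] by (simp_all add: pairing_same mult.commute)

lemma w_e_n: "qc (r * inverse s) (w n) (e n)" "qc (s * inverse r) (w' n) (e n)"
  using w_e[of n n] w'_e[of n n] n_ge_2 by (simp_all add: pairing_n mult.commute)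

lemma w_e_up: "1 \<le> i \<Longrightarrow> i < n \<Longrightarrow> qc SS (w i) (e (Suc i))"
    "1 \<le> i \<Longrightarrow> i < n \<Longrightarrow> qc RR (w' i) (e (Suc i))"
  using w_e[of "Suc i" i] w'_e[of "Suc i" i] by (simp_all add: pairing_up pairing_down)

lemma w_e_down: "1 \<le> i \<Longrightarrow> i < n \<Longrightarrow> qc (inverse RR) (w (Suc i)) (e i)"
    "1 \<le> i \<Longrightarrow> i < n \<Longrightarrow> qc (inverse SS) (w' (Suc i)) (e i)"
  using w_e[of i "Suc i"] w'_e[of i "Suc i"] by (simp_all add: pairing_up pairing_down)

lemma w_e_far: "i \<in> {1..n} \<Longrightarrow> j \<in> {1..n} \<Longrightarrow> i + 1 < j \<or> j + 1 < i \<Longrightarrow> qc 1 (w j) (e i)"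
    "i \<in> {1..n} \<Longrightarrow> j \<in> {1..n} \<Longrightarrow> i + 1 < j \<or> j + 1 < i \<Longrightarrow> qc 1 (w' j) (e i)"
  using w_e[of i j] w'_e[of i j] pairing_far[of i j] pairing_far[of j i] by auto

lemma w_E_next:
  assumes "1 \<le> k" "k \<le> j" "j < n"
  shows "qc (inverse RR) (w (Suc j)) (E k j)" "qc (inverse SS) (w' (Suc j)) (E k j)"
proof -
  have "qc (inverse RR) (w (Suc j)) (E k j) \<and> qc (inverse SS) (w' (Suc j)) (E k j)"
    using assms(2)
  proof (induction rule: inc_induct)
    case base
    then show ?case using assms w_e_down[of j] by (simp add: E_refl)
  next
    case (step m)
    then show ?case using assms w_e_far[of m "Suc j"]
      by (auto simp: E_left[of m j] intro!: qc_br_1)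
  qed
  then show "qc (inverse RR) (w (Suc j)) (E k j)" "qc (inverse SS) (w' (Suc j)) (E k j)" by auto
qed

lemma w_E_prev:
  assumes "1 \<le> k" "Suc k \<le> j" "j \<le> n"
  shows "qc SS (w k) (E (Suc k) j)" "qc RR (w' k) (E (Suc k) j)"
proof -
  have "qc SS (w k) (E (Suc k) j) \<and> qc RR (w' k) (E (Suc k) j)"
    using assms(2)
  proof (induction rule: dec_induct)
    case base
    then show ?case using assms w_e_up[of k] by (simp add: E_refl)
  next
    case (step m)
    then show ?case using assms w_e_far[of "Suc m" k]
      by (auto simp: E_right[of "Suc k" m] intro!: qc_br_2)
  qed
  then show "qc SS (w k) (E (Suc k) j)" "qc RR (w' k) (E (Suc k) j)" by auto
qed

lemma w_E_last:
  assumes "1 \<le> k" "k \<le> j" "Suc j < n"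
  shows "qc (inverse SS) (w (Suc j)) (E k (Suc j))" "qc (inverse RR) (w' (Suc j)) (E k (Suc j))"
proof -
  have E: "E k (Suc j) = br RR (E k j) (e (Suc j))" using assms by (simp add: E_right)
  show "qc (inverse SS) (w (Suc j)) (E k (Suc j))"
    unfolding E using assms
    by (intro qc_eqI[OF qc_br[OF w_E_next(1)[of k j] w_e_same(1)[of "Suc j"]]]) (auto simp: field_simps)
  show "qc (inverse RR) (w' (Suc j)) (E k (Suc j))"
    unfolding E using assms
    by (intro qc_eqI[OF qc_br[OF w_E_next(2)[of k j] w_e_same(2)[of "Suc j"]]]) (auto simp: field_simps)
qed

text \<open>Both weights are the reciprocal of the bracket scalar \<open>r * s\<close> in
  \<open>E'_n\<close>, which makes the torus term in \<open>E'_f_n\<close> vanish.\<close>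

lemma w_E_n:
  assumes "1 \<le> k" "k < n"
  shows "qc (inverse (r * s)) (w n) (E k n)" "qc (inverse (r * s)) (w' n) (E k n)"
proof -
  define m where "m = n - 1"
  have n: "Suc m = n" "k \<le> m" "m < n" using assms by (simp_all add: m_def)
  have E: "E k n = br RR (E k m) (e n)" using assms n E_right[of k m] by simp
  have next_: "qc (inverse RR) (w n) (E k m)" "qc (inverse SS) (w' n) (E k m)"
    using assms n w_E_next[of k m] by simp_all
  show "qc (inverse (r * s)) (w n) (E k n)"
    unfolding E by (intro qc_eqI[OF qc_br[OF next_(1) w_e_n(1)]])
      (auto simp: field_simps RR_def r_nz s_nz)
  show "qc (inverse (r * s)) (w' n) (E k n)"
    unfolding E by (intro qc_eqI[OF qc_br[OF next_(2) w_e_n(2)]])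
      (auto simp: field_simps SS_def r_nz s_nz)
qed

lemma w_E_first:
  assumes "1 \<le> k" "k < j" "j \<le> n"
  shows "qc RR (w k) (E k j)"
  unfolding E_left[OF assms] using assms
  by (intro qc_eqI[OF qc_br[OF w_e_same(1)[of k] w_E_prev(1)[of k j]]]) (auto simp: field_simps)

lemma w_E_mid:
  assumes "1 \<le> k" "k < i" "i < j" "j \<le> n"
  shows "qc 1 (w i) (E k j)" "qc 1 (w' i) (E k j)"
proof -
  obtain m where i: "i = Suc m" using assms by (cases i) auto
  have "Suc i \<le> j" using assms by simp
  then have "qc 1 (w i) (E k j) \<and> qc 1 (w' i) (E k j)"
  proof (induction rule: dec_induct)
    case base
    have E: "E k (Suc i) = br RR (E k i) (e (Suc i))" using assms by (simp add: E_right[of k i])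
    have l: "qc (inverse SS) (w i) (E k i)" "qc (inverse RR) (w' i) (E k i)"
      using w_E_last[of k m] assms i by simp_all
    have "qc 1 (w i) (E k (Suc i))" unfolding E using assms
      by (intro qc_eqI[OF qc_br[OF l(1) w_e_up(1)]]) simp_all
    moreover have "qc 1 (w' i) (E k (Suc i))" unfolding E using assms
      by (intro qc_eqI[OF qc_br[OF l(2) w_e_up(2)]]) simp_all
    ultimately show ?case by simp
  next
    case (step q)
    then show ?case using assms w_e_far[of "Suc q" i]
      by (auto simp: E_right[of k q] intro!: qc_br_2)
  qed
  then show "qc 1 (w i) (E k j)" "qc 1 (w' i) (E k j)" by auto
qed

lemma w_E'_before:
  assumes "1 \<le> k" "k < i" "Suc i < j" "j \<le> n"
  shows "qc 1 (w i) (E' k j)" "qc 1 (w' i) (E' k j)"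
proof -
  have "qc 1 (w i) (E' k j) \<and> qc 1 (w' i) (E' k j)"
    using assms(4)
  proof (induction rule: inc_induct)
    case base
    show ?case using w_E_mid[of k i n] w_e_far[of n i] assms by (auto simp: E'_n intro!: qc_br_1)
  next
    case (step m)
    then show ?case using w_e_far[of m i] assms by (auto simp: E'_step[of k m] intro!: qc_br_1)
  qed
  then show "qc 1 (w i) (E' k j)" "qc 1 (w' i) (E' k j)" by auto
qed

lemma w_pv_before:
  assumes "1 \<le> k" "k < j" "Suc j \<le> n"
  shows "qc 1 (w j) (pv k (Suc j))" "qc 1 (w' j) (pv k (Suc j))"
  using assms w_E_mid[of k j n] w_E'_before[of k j "Suc (Suc j)"] by (auto simp: pv_def)

lemma w_E'_Suc:
  assumes "1 \<le> k" "k < j" "j < n"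
  shows "qc SS (w j) (E' k (Suc j))" "qc RR (w' j) (E' k (Suc j))"
proof -
  have E: "E' k (Suc j) = br (pc (Suc j)) (pv k (Suc j)) (e (Suc j))"
    using assms by (intro E'_pv) auto
  show "qc SS (w j) (E' k (Suc j))" "qc RR (w' j) (E' k (Suc j))"
    unfolding E using assms w_pv_before[of k j] w_e_up[of j] by (auto intro!: qc_br_1)
qed

lemma w'_E'_last:
  assumes "1 \<le> k" "k < j" "j < n"
  shows "qc SS (w' j) (E' k j)"
  unfolding E'_step[OF assms] using assms
  by (intro qc_eqI[OF qc_br[OF w_E'_Suc(2) w_e_same(2)]]) (auto simp: field_simps)

lemma w'_E'_n:
  assumes "1 \<le> k" "k < n"
  shows "qc (inverse RR) (w' n) (E' k n)"
  unfolding E'_n[OF assms]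
  by (intro qc_eqI[OF qc_br[OF w_E_n(2)[OF assms] w_e_n(2)]]) (auto simp: field_simps RR_def r_nz s_nz)

lemma w_E'_prev:
  assumes "1 \<le> k" "Suc k < j" "j \<le> n"
  shows "qc SS (w k) (E' (Suc k) j)" "qc RR (w' k) (E' (Suc k) j)"
proof -
  have "qc SS (w k) (E' (Suc k) j) \<and> qc RR (w' k) (E' (Suc k) j)"
    using assms(3)
  proof (induction rule: inc_induct)
    case base
    show ?case using w_E_prev[of k n] w_e_far[of n k] assms by (auto simp: E'_n intro!: qc_br_2)
  next
    case (step m)
    then show ?case using w_e_far[of m k] assms by (auto simp: E'_step[of "Suc k" m] intro!: qc_br_2)
  qed
  then show "qc SS (w k) (E' (Suc k) j)" "qc RR (w' k) (E' (Suc k) j)" by auto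
qed

lemma w_E'_first:
  assumes "1 \<le> k" "Suc k < j" "j \<le> n"
  shows "qc RR (w k) (E' k j)"
  unfolding E'_left[OF assms] using assms
  by (intro qc_eqI[OF qc_br[OF w_e_same(1)[of k] w_E'_prev(1)[of k j]]]) (auto simp: field_simps)

lemma w_E'_top:
  assumes "1 \<le> k" "Suc k \<le> n"
  shows "qc (RR * SS) (w k) (E' k (Suc k))"
proof -
  have "E' k (Suc k) = br (pc (Suc k)) (pv k (Suc k)) (e (Suc k))"
    using assms by (intro E'_pv) auto
  moreover have "qc RR (w k) (pv k (Suc k))"
    using assms w_E_first[of k n] w_E'_first[of k "Suc (Suc k)"] by (auto simp: pv_def)
  ultimately show ?thesis
    using assms w_e_up(1)[of k] qc_br by auto
qed

section \<open>Commutators of root vectors with the \<open>f i\<close>\<close>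

definition eta where "eta i = inverse (rr n r i - rr n s i)"

lemma eta_nz: "i \<in> {1..n} \<Longrightarrow> eta i \<noteq> 0"
  using squares_ne r_ne_s by (auto simp: eta_def rr_def RR_def SS_def power2_eq_square)

lemma eta_RR: "i < n \<Longrightarrow> eta i * (RR - SS) = 1"
  using squares_ne by (auto simp: eta_def rr_def RR_def SS_def power2_eq_square)

lemma e_f_same: "i \<in> {1..n} \<Longrightarrow> br 1 (e i) (f i) = eta i \<star> (w i - w' i)"
  using e_f[of i i] by (simp add: eta_def)

lemma e_f_comm: "i \<in> {1..n} \<Longrightarrow> j \<in> {1..n} \<Longrightarrow> i \<noteq> j \<Longrightarrow> qc 1 (e i) (f j)"
  using e_f[of i j] by (simp add: br_eq_0_iff)

text \<open>For \<open>t * a = 1\<close> the term with \<open>w i\<close> drops out, so that the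
  commutators below end in a single torus element.\<close>

lemma br_torus_right:
  assumes "qc a (w i) x" "qc b (w' i) x"
  shows "br t x (c \<star> (w i - w' i)) = c \<star> ((1 - t * a) \<star> (x * w i) + (t * b - 1) \<star> (x * w' i))"
  using assms by (simp add: br_def qc_def expand)

lemma br_torus_left:
  assumes "qc a (w i) x" "qc b (w' i) x"
  shows "br t (c \<star> (w i - w' i)) x = c \<star> ((a - t) \<star> (x * w i) + (t - b) \<star> (x * w' i))"
  using assms by (simp add: br_def qc_def expand)

lemma E_f_out:
  assumes "1 \<le> k" "k \<le> j" "j \<le> n" "i \<in> {1..n}" "i \<notin> {k..j}"
  shows "qc 1 (E k j) (f i)"
  using assms(2)
proof (induction rule: inc_induct)
  case base
  then show ?case using assms e_f_comm[of j i] by (auto simp: E_refl)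
next
  case (step m)
  then show ?case using assms e_f_comm[of m i] by (auto simp: E_left[of m j] intro!: qc_br_left_1)
qed

lemma E_f_last:
  assumes "1 \<le> k" "k \<le> j" "j < n"
  shows "br 1 (E k (Suc j)) (f (Suc j)) = (eta (Suc j) * (RR * inverse SS - 1)) \<star> (E k j * w' (Suc j))"
proof -
  have "br 1 (E k j) (f (Suc j)) = 0"
    using E_f_out[of k j "Suc j"] assms by (simp add: br_eq_0_iff)
  then have "br 1 (E k (Suc j)) (f (Suc j)) = br RR (E k j) (eta (Suc j) \<star> (w (Suc j) - w' (Suc j)))"
    using assms by (simp add: E_right[of k j] br_br_derivation e_f_same)
  also have "\<dots> = (eta (Suc j) * (RR * inverse SS - 1)) \<star> (E k j * w' (Suc j))"
    using br_torus_right[OF w_E_next[OF assms], of RR] by simp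
  finally show ?thesis .
qed

lemma E_f_first:
  assumes "1 \<le> k" "k < j" "j \<le> n"
  shows "br 1 (E k j) (f k) = - (E (Suc k) j * w k)"
proof -
  have "br 1 (E (Suc k) j) (f k) = 0"
    using E_f_out[of "Suc k" j k] assms by (simp add: br_eq_0_iff)
  then have "br 1 (E k j) (f k) = br RR (eta k \<star> (w k - w' k)) (E (Suc k) j)"
    using assms by (simp add: E_left[of k j] br_br_derivation e_f_same)
  also have "\<dots> = (eta k * (SS - RR)) \<star> (E (Suc k) j * w k)"
    using br_torus_left[OF w_E_prev[of k j], of RR] assms by simp
  also have "eta k * (SS - RR) = - 1"
    using eta_RR[of k] assms by (simp add: algebra_simps)
  finally show ?thesis by simp
qed

text \<open>Only the letter \<open>e i\<close> interacts with \<open>f i\<close>. It leaves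
  \<open>E k (i - 1) * w' i\<close>, and this q-commutes with \<open>e (Suc i)\<close> with exactly
  the scalar of the next bracket, which kills it.\<close>

lemma E_f_mid:
  assumes "1 \<le> k" "k < i" "i < j" "j \<le> n"
  shows "qc 1 (E k j) (f i)"
proof -
  obtain m where i: "i = Suc m" using assms by (cases i) auto
  have "Suc i \<le> j" using assms by simp
  then show ?thesis
  proof (induction rule: dec_induct)
    case base
    have "qc RR (E k m * w' i) (e (Suc i))"
      using qc_mult_left[OF qc_1_sym[OF E_far[of k m "Suc i"]] w_e_up(2)[of i]] assms i by simp
    then have "br RR (br 1 (E k i) (f i)) (e (Suc i)) = 0"
      using E_f_last[of k m] assms i by (simp add: br_scale br_eq_0_iff)
    moreover have "br 1 (e (Suc i)) (f i) = 0"
      using e_f_comm[of "Suc i" i] assms by (simp add: br_eq_0_iff)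
    ultimately show ?case
      using assms by (simp add: E_right[of k i] br_br_derivation flip: br_eq_0_iff)
  next
    case (step q)
    then show ?case using assms e_f_comm[of "Suc q" i]
      by (auto simp: E_right[of k q] intro!: qc_br_left_1)
  qed
qed

lemma E'_f_n:
  assumes "1 \<le> k" "k < n"
  shows "\<exists>c. c \<noteq> 0 \<and> br 1 (E' k n) (f n) = c \<star> (E k n * w' n)"
proof -
  define m where "m = n - 1"
  have n: "Suc m = n" "k \<le> m" "m < n" using assms by (simp_all add: m_def)
  define c where "c = eta n * (RR * inverse SS - 1)"
  have E: "E k n = br RR (E k m) (e n)" using assms n E_right[of k m] by simp
  \<comment> \<open>Moving \<open>w' n\<close> to the right past \<open>e n\<close> turns the
    bracket scalar \<open>r * s\<close> into \<open>RR\<close>, and the bracket becomes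
    \<open>E k n\<close>.\<close>
  have "br (r * s) (E k m * w' n) (e n) = (s * inverse r) \<star> (E k n * w' n)"
  proof -
    have "br (r * s) (E k m * w' n) (e n)
       = E k m * (w' n * e n) - (r * s) \<star> (e n * E k m * w' n)"
      by (simp add: br_def mult.assoc)
    also have "\<dots> = (s * inverse r) \<star> (E k m * e n * w' n) - (s * inverse r * RR) \<star> (e n * E k m * w' n)"
      using qcD[OF w_e_n(2)] r_nz by (simp add: expand RR_def)
    finally show ?thesis unfolding E by (simp add: br_def expand)
  qed
  then have "br (r * s) (br 1 (E k n) (f n)) (e n) = (c * (s * inverse r)) \<star> (E k n * w' n)"
    using E_f_last[of k m] assms n by (simp add: c_def br_scale)
  moreover have "br (r * s) (E k n) (br 1 (e n) (f n)) = 0"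
  proof -
    have "r * s * inverse (r * s) = 1" using r_nz s_nz by (intro right_inverse) simp
    then show ?thesis
      using br_torus_right[OF w_E_n[OF assms], of "r * s" "eta n"] e_f_same[of n] n_ge_2
      by (simp del: inverse_mult_distrib)
  qed
  ultimately have "br 1 (E' k n) (f n) = (c * (s * inverse r)) \<star> (E k n * w' n)"
    using assms by (simp add: E'_n br_br_derivation)
  moreover have "c * (s * inverse r) \<noteq> 0"
    using r_nz s_nz squares_ne eta_nz[of n] n_ge_2 by (simp add: c_def field_simps)
  ultimately show ?thesis by blast
qed

text \<open>The two claims need one common induction: that \<open>f (Suc q)\<close> commutes with
  \<open>E' k q\<close> follows from the explicit commutator of \<open>E' k (Suc q)\<close> with it,
  which the bracket with \<open>e q\<close> annihilates.\<close>

lemma E'_f_rest: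
  assumes "1 \<le> k" "k < j" "j \<le> n"
  shows "(\<forall>i\<in>{1..n}. i \<noteq> k \<longrightarrow> i \<noteq> j \<longrightarrow> qc 1 (E' k j) (f i)) \<and>
    (\<exists>c. c \<noteq> 0 \<and> br 1 (E' k j) (f j) = c \<star> (pv k j * w' j))"
  using assms(3)
proof (induction rule: inc_induct)
  case base
  have "qc 1 (E' k n) (f i)" if "i \<in> {1..n}" "i \<noteq> k" "i \<noteq> n" for i
  proof -
    have "qc 1 (E k n) (f i)"
      using that E_f_out[of k n i] E_f_mid[of k i n] assms by (cases "i < k") auto
    then show ?thesis using that e_f_comm[of n i] assms by (auto simp: E'_n intro!: qc_br_left_1)
  qed
  then show ?case using E'_f_n[of k] assms by (simp add: pv_def)
next
  case (step q)
  have q: "k < q" "q < n" using step assms by auto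
  from step.IH obtain c where c: "c \<noteq> 0" "br 1 (E' k (Suc q)) (f (Suc q)) = c \<star> (pv k (Suc q) * w' (Suc q))"
    and IH: "\<And>i. i \<in> {1..n} \<Longrightarrow> i \<noteq> k \<Longrightarrow> i \<noteq> Suc q \<Longrightarrow> qc 1 (E' k (Suc q)) (f i)" by blast
  have E: "E' k q = br (inverse SS) (E' k (Suc q)) (e q)" using q assms by (simp add: E'_step[of k q])
  have "qc 1 (E' k q) (f i)" if "i \<in> {1..n}" "i \<noteq> k" "i \<noteq> q" for i
  proof (cases "i = Suc q")
    case True
    have "qc (inverse SS) (pv k (Suc q) * w' (Suc q)) (e q)"
      using qc_mult_left[OF qc_1_sym[OF pv_comm[of k q]] w_e_down(2)[of q]] q assms by simp
    then have "br (inverse SS) (br 1 (E' k (Suc q)) (f i)) (e q) = 0"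
      using c True by (simp add: br_scale br_eq_0_iff)
    moreover have "br 1 (e q) (f i) = 0"
      using e_f_comm[of q i] that q assms by (simp add: br_eq_0_iff)
    ultimately show ?thesis by (simp add: E br_br_derivation flip: br_eq_0_iff)
  next
    case False
    then show ?thesis using that IH[of i] e_f_comm[of q i] q assms by (auto simp: E intro!: qc_br_left_1)
  qed
  moreover have "br 1 (E' k q) (f q) = (eta q * (inverse SS * RR - 1)) \<star> (pv k q * w' q)"
  proof -
    have "br 1 (E' k (Suc q)) (f q) = 0" using IH[of q] q assms by (simp add: br_eq_0_iff)
    then have "br 1 (E' k q) (f q) = br (inverse SS) (E' k (Suc q)) (eta q \<star> (w q - w' q))"
      using q assms by (simp add: E br_br_derivation e_f_same)
    also have "\<dots> = (eta q * (inverse SS * RR - 1)) \<star> (E' k (Suc q) * w' q)"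
      using br_torus_right[OF w_E'_Suc[of k q], of "inverse SS"] q assms by simp
    finally show ?thesis using q by (simp add: pv_def)
  qed
  moreover have "eta q * (inverse SS * RR - 1) \<noteq> 0"
    using squares_ne eta_nz[of q] q assms by (simp add: field_simps)
  ultimately show ?case by blast
qed

lemma E'_f_other:
  "1 \<le> k \<Longrightarrow> k < j \<Longrightarrow> j \<le> n \<Longrightarrow> i \<in> {1..n} \<Longrightarrow> i \<noteq> k \<Longrightarrow> i \<noteq> j \<Longrightarrow> qc 1 (E' k j) (f i)"
  using E'_f_rest by blast

lemma E'_f_last:
  assumes "1 \<le> k" "k < j" "j \<le> n"
  obtains c where "c \<noteq> 0" "br 1 (E' k j) (f j) = c \<star> (pv k j * w' j)"
  using E'_f_rest[OF assms] by blast

lemma E'_f_first: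
  assumes "1 \<le> k" "Suc k < j" "j \<le> n"
  shows "br 1 (E' k j) (f k) = - (E' (Suc k) j * w k)"
proof -
  have "br 1 (E' (Suc k) j) (f k) = 0"
    using E'_f_other[of "Suc k" j k] assms by (simp add: br_eq_0_iff)
  then have "br 1 (E' k j) (f k) = br RR (eta k \<star> (w k - w' k)) (E' (Suc k) j)"
    using assms by (simp add: E'_left[of k j] br_br_derivation e_f_same)
  also have "\<dots> = (eta k * (SS - RR)) \<star> (E' (Suc k) j * w k)"
    using br_torus_left[OF w_E'_prev[of k j], of RR] assms by simp
  also have "eta k * (SS - RR) = - 1"
    using eta_RR[of k] assms by (simp add: algebra_simps)
  finally show ?thesis by simp
qed

text \<open>The scalar is a product over the letters of \<open>E' j i\<close>:
  \<open>inverse RR\<close> for the single \<open>e j\<close>, \<open>RR * SS\<close> for each of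
  the two \<open>e n\<close>, and 1 for all others.\<close>

lemma E'_qc_E':
  assumes "1 \<le> k" "k < j" "j < i" "i \<le> n"
  shows "qc (SS * (RR * SS)) (E' k j) (E' j i)"
proof -
  have "qc (RR * SS) (E' k j) (E (Suc j) n)"
  proof -
    have "Suc j \<le> n" using assms by simp
    then show ?thesis
    proof (induction rule: inc_induct)
      case base
      show ?case using E'_after_n[of k j] assms by (simp add: E_refl)
    next
      case (step m)
      then show ?case using qc_1_sym[OF E'_after[of k j m]] assms
        by (auto simp: E_left[of m n] intro!: qc_br_1)
    qed
  qed
  then have n: "qc SS (E' k j) (E j n)"
    using assms E_left[of j n] by (auto intro!: qc_eqI[OF qc_br[OF E'_last[of k j]]])
  show ?thesis
    using assms(4)
  proof (induction rule: inc_induct)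
    case base
    show ?case using qc_br[OF n E'_after_n[of k j]] assms by (simp add: E'_n)
  next
    case (step m)
    then show ?case using qc_1_sym[OF E'_after[of k j m]] assms
      by (auto simp: E'_step[of j m] intro!: qc_br_2)
  qed
qed

text \<open>This replaces \<open>E'_f_first\<close> at the end of a row, where
  \<open>E' (Suc m) (Suc m)\<close> does not exist. \<open>P\<close> is a multiple of the square of
  \<open>e n\<close> if \<open>Suc m = n\<close>, and otherwise a twisted bracket of
  \<open>e (Suc m)\<close> with the last vector of row \<open>Suc m\<close>.\<close>

lemma E'_f_top:
  assumes "1 \<le> m" "Suc m \<le> n"
  obtains P where "br 1 (E' m (Suc m)) (f m) = P * w m"
    "\<And>k. 1 \<le> k \<Longrightarrow> k \<le> m \<Longrightarrow> qc (SS * SS) (E' k (Suc m)) P"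
proof (cases "Suc m = n")
  case True
  have "br 1 (e n) (f m) = 0" using e_f_comm[of n m] assms True by (simp add: br_eq_0_iff)
  then have "br 1 (E' m n) (f m) = br (r * s) (br 1 (E m n) (f m)) (e n)"
    using assms by (simp add: E'_n br_br_derivation)
  also have "\<dots> = - br (r * s) (e n * w m) (e n)"
    using E_f_first[of m n] assms True E_refl[of n] by (simp add: br_uminus)
  also have "br (r * s) (e n * w m) (e n) = e n * (w m * e n) - (r * s) \<star> (e n * e n * w m)"
    by (simp add: br_def mult.assoc)
  also have "w m * e n = SS \<star> (e n * w m)" using w_e_up(1)[of m] assms True by (simp add: qc_def)
  finally have "br 1 (E' m (Suc m)) (f m) = ((r * s - SS) \<star> (e n * e n)) * w m"
    using True by (simp add: expand)
  moreover have "qc (SS * SS) (E' k (Suc m)) ((r * s - SS) \<star> (e n * e n))" if "1 \<le> k" "k \<le> m" for k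
    using E'_n_last[of k] that True by (auto intro!: qc_scale qc_mult)
  ultimately show ?thesis using that by blast
next
  case False
  define j where "j = Suc m"
  have j: "m < j" "j < n" "1 \<le> j" "Suc m = j" using assms False by (auto simp: j_def)
  define Y where "Y = E' j (Suc j)"
  have "br 1 (e j) (f m) = 0" using e_f_comm[of j m] assms j by (simp add: br_eq_0_iff)
  then have "br 1 (E' m j) (f m) = br (inverse SS) (br 1 (E' m (Suc j)) (f m)) (e j)"
    using assms j by (simp add: E'_step[of m j] br_br_derivation)
  also have "\<dots> = - br (inverse SS) (Y * w m) (e j)"
    using E'_f_first[of m "Suc j"] assms j by (simp add: br_uminus Y_def)
  also have "br (inverse SS) (Y * w m) (e j) = Y * (w m * e j) - inverse SS \<star> (e j * Y * w m)"
    by (simp add: br_def mult.assoc)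
  also have "w m * e j = SS \<star> (e j * w m)" using w_e_up(1)[of m] assms j by (simp add: qc_def)
  finally have "br 1 (E' m (Suc m)) (f m) = (inverse SS \<star> (e j * Y) - SS \<star> (Y * e j)) * w m"
    using j by (simp add: expand)
  moreover have "qc (SS * SS) (E' k (Suc m)) (inverse SS \<star> (e j * Y) - SS \<star> (Y * e j))"
    if "1 \<le> k" "k \<le> m" for k
  proof -
    have a: "qc (inverse RR) (E' k j) (e j)" using E'_last[of k j] that j by simp
    have b: "qc (SS * (RR * SS)) (E' k j) Y" using E'_qc_E'[of k j "Suc j"] that j by (simp add: Y_def)
    have "qc (SS * SS) (E' k j) (e j * Y)" "qc (SS * SS) (E' k j) (Y * e j)"
      by (rule qc_eqI[OF qc_mult[OF a b]], simp add: field_simps)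
        (rule qc_eqI[OF qc_mult[OF b a]], simp add: field_simps)
    then show ?thesis using j by (auto intro!: qc_diff qc_scale)
  qed
  ultimately show ?thesis using that by blast
qed

section \<open>Powers of root vectors\<close>

text \<open>Forgets the value of the scalar: as soon as it is an \<open>l\<close>-th root of unity,
  the \<open>l\<close>-th power of either element commutes with the other one.\<close>

definition qcr where "qcr x y \<longleftrightarrow> (\<exists>c. c ^ l = 1 \<and> qc c x y)"

lemma qcrI: "qc c x y \<Longrightarrow> c ^ l = 1 \<Longrightarrow> qcr x y"
  by (auto simp: qcr_def)

lemma qcr_br: "qcr x y \<Longrightarrow> qcr x z \<Longrightarrow> qcr x (br t y z)"
  unfolding qcr_def by (metis qc_br power_mult_distrib mult_1)

lemma qcr_power: "qcr x y \<Longrightarrow> qc 1 (y ^ l) x"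
  unfolding qcr_def by (metis qc_power qc_1_sym)

lemma qcr_power_left: "qcr x y \<Longrightarrow> qc 1 (x ^ l) y"
  unfolding qcr_def by (metis qc_power_left)

lemma qcr_E:
  assumes "\<And>i. k \<le> i \<Longrightarrow> i \<le> n \<Longrightarrow> qcr x (e i)" "1 \<le> k" "k \<le> j" "j \<le> n"
  shows "qcr x (E k j)"
  using assms(3)
proof (induction rule: inc_induct)
  case base
  then show ?case using assms by (simp add: E_refl)
next
  case (step m)
  then show ?case using assms by (auto simp: E_left[of m j] intro!: qcr_br)
qed

lemma qcr_E':
  assumes "\<And>i. k \<le> i \<Longrightarrow> i \<le> n \<Longrightarrow> qcr x (e i)" "1 \<le> k" "k < j" "j \<le> n"
  shows "qcr x (E' k j)"
  using assms(4)
proof (induction rule: inc_induct)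
  case base
  then show ?case using assms qcr_E[of k x n] by (auto simp: E'_n intro!: qcr_br)
next
  case (step m)
  then show ?case using assms by (auto simp: E'_step[of k m] intro!: qcr_br)
qed

lemma torus_qcr:
  assumes "i \<in> {1..n}" "j \<in> {1..n}"
  shows "qcr (w i) (e j)" "qcr (w' i) (e j)"
  using w_e[of j i] w'_e[of j i] assms by (auto intro!: qcrI simp: power_inverse)

text \<open>Covers all letters of the rows after \<open>m\<close>, hence all vectors of those rows;
  this supplies the hypothesis \<open>T\<close> of \<open>row_commutes\<close>.\<close>

lemma top_qcr:
  assumes "1 \<le> m" "Suc m \<le> i" "i \<le> n"
  shows "qcr (E' m (Suc m)) (e i)"
proof -
  consider "i = Suc m" "i < n" | "i = Suc m" "i = n" | "Suc m < i" "i < n" | "Suc m < i" "i = n"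
    using assms by linarith
  then show ?thesis
  proof cases
    case 1
    then show ?thesis using E'_last[of m i] assms by (auto intro!: qcrI simp: power_inverse)
  next
    case 2
    then show ?thesis using E'_n_last[of m] assms by (auto intro!: qcrI)
  next
    case 3
    then show ?thesis using qc_1_sym[OF E'_after[of m "Suc m" i]] assms by (auto intro!: qcrI)
  next
    case 4
    then show ?thesis using E'_after_n[of m "Suc m"] assms by (auto intro!: qcrI simp: power_mult_distrib)
  qed
qed

section \<open>Descent along a row to its first letter\<close>

lemma descend_E:
  assumes "\<And>i. i \<in> {1..n} \<Longrightarrow> qc 1 X (w' i)" "\<And>i. k < i \<Longrightarrow> i \<le> n \<Longrightarrow> qc 1 X (f i)"
    and "1 \<le> k" "k \<le> j" "j \<le> n" "qc 1 X (E k j)"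
  shows "qc 1 X (e k)"
proof -
  have "qc 1 X (E k j) \<longrightarrow> qc 1 X (e k)"
    using assms(4)
  proof (induction rule: dec_induct)
    case base
    show ?case using assms by (simp add: E_refl)
  next
    case (step m)
    have "qc 1 X (E k m)" if "qc 1 X (E k (Suc m))"
    proof (rule qc_1_right_cancel)
      have "qc 1 X (br 1 (E k (Suc m)) (f (Suc m)))"
        using that assms step by (intro qc_br_1) auto
      then show "qc 1 X ((eta (Suc m) * (RR * inverse SS - 1)) \<star> (E k m * w' (Suc m)))"
        using E_f_last[of k m] assms step by simp
      show "eta (Suc m) * (RR * inverse SS - 1) \<noteq> 0"
        using eta_nz[of "Suc m"] squares_ne assms step by (auto simp: field_simps)
      show "qc 1 X (w' (Suc m))" "w' (Suc m) * wi' (Suc m) = 1"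
        using assms step w_inverse by auto
    qed
    then show ?case using step by blast
  qed
  then show ?thesis using assms by blast
qed

lemma descend_E':
  assumes "\<And>i. i \<in> {1..n} \<Longrightarrow> qc 1 X (w' i)" "\<And>i. k < i \<Longrightarrow> i \<le> n \<Longrightarrow> qc 1 X (f i)"
    and "1 \<le> k" "k < j" "j \<le> n" "qc 1 X (E' k j)"
  shows "qc 1 X (e k)"
proof -
  have pv: "qc 1 X (pv k m)" if m: "qc 1 X (E' k m)" "k < m" "m \<le> n" for m
  proof -
    obtain c where c: "c \<noteq> 0" "br 1 (E' k m) (f m) = c \<star> (pv k m * w' m)"
      by (rule E'_f_last[OF assms(3) m(2,3)])
    have "qc 1 X (br 1 (E' k m) (f m))" using that assms by (intro qc_br_1) auto
    then show ?thesis
      using c that assms w_inverse(2)[of m] by (intro qc_1_right_cancel[of X c "pv k m" "w' m"]) auto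
  qed
  have "qc 1 X (E' k j) \<longrightarrow> qc 1 X (e k)"
    using assms(5)
  proof (induction rule: inc_induct)
    case base
    show ?case using pv[of n] descend_E[of X k n] assms by (auto simp: pv_def)
  next
    case (step m)
    then show ?case using pv[of m] assms by (auto simp: pv_def)
  qed
  then show ?thesis using assms by blast
qed

text \<open>The generator left open by the hypotheses is \<open>e (k - 1)\<close>; it is reached by
  descending from the last vector of row \<open>k - 1\<close>.\<close>

lemma row_commutes:
  assumes "k \<in> {1..n}"
    and w: "\<And>i. i \<in> {1..n} \<Longrightarrow> qc 1 X (w i)" "\<And>i. i \<in> {1..n} \<Longrightarrow> qc 1 X (w' i)"
    and f: "\<And>i. i \<in> {1..n} \<Longrightarrow> qc 1 X (f i)"
    and e: "\<And>i. k \<le> i \<Longrightarrow> i \<le> n \<Longrightarrow> qc 1 X (e i)" "\<And>i. 1 \<le> i \<Longrightarrow> Suc i < k \<Longrightarrow> qc 1 X (e i)"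
    and T: "\<And>m. k = Suc m \<Longrightarrow> 1 \<le> m \<Longrightarrow> qc 1 X (E' m (Suc m))"
  shows "\<forall>i\<in>{1..n}. qc 1 X (e i) \<and> qc 1 X (f i) \<and> qc 1 X (w i) \<and> qc 1 X (w' i)"
proof -
  have "qc 1 X (e i)" if "i \<in> {1..n}" "k = Suc i" for i
    using descend_E'[of X i "Suc i"] T[of i] w f that assms(1) by auto
  moreover have "k \<le> i \<or> k = Suc i \<or> Suc i < k" for i by linarith
  ultimately show ?thesis using assms by (metis atLeastAtMost_iff)
qed

section \<open>Powers of the unprimed vectors\<close>

text \<open>A chain of length three from \<open>f k\<close> through the torus to
  \<open>w' k * e k\<close>, with scalars 1, \<open>inverse t\<close> and \<open>t\<close>.
  Distinctness means \<open>t * t \<noteq> 1\<close>, which for \<open>k < n\<close> is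
  \<open>r ^ 4 \<noteq> s ^ 4\<close>.\<close>

lemma e_power_f:
  assumes "k \<in> {1..n}"
  shows "qc 1 (e k ^ l) (f k)"
proof -
  define t where "t = pairing n r s k k"
  have t: "t \<noteq> 0" "t * t \<noteq> 1"
  proof -
    show "t \<noteq> 0" using r_nz s_nz by (auto simp: t_def pairing_def)
    have "RR * RR \<noteq> SS * SS" using fourth_ne by (simp add: RR_def SS_def numeral_eq_Suc mult.assoc)
    then show "t * t \<noteq> 1"
      using squares_ne s_nz assms
      by (cases "k < n") (auto simp: t_def pairing_same pairing_n field_simps RR_def SS_def)
  qed
  have w: "qc (inverse t) (e k) (w k)" "qc t (e k) (w' k)"
    using t w_e[of k k] w'_e[of k k] assms
    by (auto simp: t_def intro!: qc_sym[of "pairing n r s k k" "w k"] qc_sym[of "inverse (pairing n r s k k)" "w' k"])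
  show ?thesis
  proof (rule power_commute_br3)
    show "br 1 (e k) (f k) = eta k \<star> (w k - w' k)" using assms by (rule e_f_same)
    \<comment> \<open>The scalar \<open>inverse t\<close> is chosen to remove the part with
      \<open>w k\<close>.\<close>
    show "br (inverse t) (e k) (eta k \<star> (w k - w' k)) = (eta k * (inverse t - t)) \<star> (w' k * e k)"
      using w by (simp add: br_def qc_def expand)
    show "qc t (e k) ((eta k * (inverse t - t)) \<star> (w' k * e k))"
      using qc_mult[OF w(2), of 1 "e k"] by (auto intro!: qc_scale simp: qc_1)
    show "1 \<noteq> inverse t" "inverse t \<noteq> t" "1 \<noteq> t" using t by (auto simp: field_simps)
    show "1 ^ l = (1::'k)" "inverse t ^ l = 1" "t ^ l = 1" by (simp_all add: t_def power_inverse)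
  qed
qed

text \<open>Only the end letters of \<open>E k j\<close> interact with the \<open>f i\<close>. For
  \<open>k < j\<close> both ends give chains of length two, except that \<open>f k\<close> against
  \<open>E k n\<close> needs length three.\<close>

lemma E_power_f:
  assumes "1 \<le> k" "k \<le> j" "j \<le> n" "i \<in> {1..n}"
  shows "qc 1 (E k j ^ l) (f i)"
proof -
  consider "i \<notin> {k, j}" | "i = k" "k = j" | "k < j" "i = j" | "k < j" "i = k" "j < n" | "k < j" "i = k" "j = n"
    using assms by fastforce
  then show ?thesis
  proof cases
    case 1
    then have "qc 1 (E k j) (f i)"
      using E_f_out[of k j i] E_f_mid[of k i j] assms by (cases "i \<in> {k..j}") auto
    then show ?thesis using qc_power_left[of 1 "E k j" "f i" l] by simp
  next
    case 2
    then show ?thesis using e_power_f[of k] assms by (simp add: E_refl)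
  next
    case 3
    then obtain q where q: "j = Suc q" "k \<le> q" by (cases j) auto
    have a: "qc (inverse SS) (E k j) (E k q)"
      using qc_sym[OF adjacent_E[of k q]] q assms by simp
    \<comment> \<open>The scalar for \<open>E k j\<close> against \<open>w' j\<close>, which depends
      on whether the last letter is \<open>e n\<close>.\<close>
    define t where "t = (if j < n then RR else r * s)"
    have t: "qc t (E k j) (w' j)" "inverse SS * t \<noteq> 1" "(inverse SS * t) ^ l = 1"
      using qc_sym[OF w_E_last(2)[of k q]] qc_sym[OF w_E_n(2)[of k]] q assms squares_ne r_ne_s r_nz s_nz
      by (auto simp: t_def field_simps power_mult_distrib power_inverse simp del: inverse_mult_distrib) (auto simp: SS_def field_simps r_root s_root)
    show ?thesis
    proof (rule power_commute_br2)
      show "br 1 (E k j) (f i) = (eta j * (RR * inverse SS - 1)) \<star> (E k q * w' j)"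
        using E_f_last[of k q] q 3 assms by simp
      show "qc (inverse SS * t) (E k j) ((eta j * (RR * inverse SS - 1)) \<star> (E k q * w' j))"
        using qc_mult[OF a t(1)] by (rule qc_scale)
    qed (use t in auto)
  next
    case 4
    have a: "qc SS (E k j) (E (Suc k) j)"
    proof -
      have "Suc k \<le> j" using 4 by simp
      then show ?thesis
      proof (induction rule: inc_induct)
        case base
        obtain q where "j = Suc q" using 4 by (cases j) auto
        then show ?case using E_last[of k q] 4 assms by (simp add: E_refl)
      next
        case (step m)
        then show ?case using qc_1_sym[OF E_mid[of k m j]] 4 assms
          by (auto simp: E_left[of m j] intro!: qc_br_1)
      qed
    qed
    have b: "qc (inverse RR) (E k j) (w k)"
      using qc_sym[OF w_E_first[of k j]] 4 assms by simp
    show ?thesis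
    proof (rule power_commute_br2)
      show "br 1 (E k j) (f i) = - (E (Suc k) j * w k)"
        using E_f_first[of k j] 4 assms by simp
      show "qc (SS * inverse RR) (E k j) (- (E (Suc k) j * w k))"
        using qc_mult[OF a b] by (rule qc_uminus)
      show "1 \<noteq> SS * inverse RR" using squares_ne by (auto simp: field_simps)
    qed (auto simp: power_mult_distrib power_inverse)
  next
    case 5
    \<comment> \<open>The middle element of the chain is not annihilated by its bracket, and
      \<open>D (Suc k)\<close> is what remains. Since \<open>D n = E' k n\<close> and the letters
      between commute with \<open>E k n\<close>, it inherits the scalar \<open>SS\<close>.\<close>
    define D where "D m = br (r * s) (E k n) (E m n)" for m
    have a: "qc SS (E k n) (D (Suc k))"
    proof -
      have "Suc k \<le> n" using 5 by simp
      then show ?thesis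
      proof (induction rule: inc_induct)
        case base
        show ?case using adjacent_E_E'[of k] E'_n[of k] 5 assms by (simp add: E_refl D_def)
      next
        case (step m)
        have "qc 1 (E k n) (e m)" using qc_1_sym[OF E_mid[of k m n]] step 5 assms by simp
        moreover have "E m n = br RR (e m) (E (Suc m) n)" using step 5 assms by (simp add: E_left[of m n])
        ultimately show ?case using step.IH by (auto simp: D_def br_left_comm intro!: qc_br_1)
      qed
    qed
    have b: "qc (inverse RR) (E k n) (w k)"
      using qc_sym[OF w_E_first[of k n]] 5 assms by simp
    show ?thesis
    proof (rule power_commute_br3)
      show "br 1 (E k j) (f i) = - (E (Suc k) n * w k)"
        using E_f_first[of k n] 5 assms by simp
      \<comment> \<open>The factor \<open>r * s\<close> comes from \<open>D\<close>, and
        \<open>inverse RR\<close> from moving \<open>E k n\<close> past \<open>w k\<close>.\<close>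
      show "br (r * s * inverse RR) (E k j) (- (E (Suc k) n * w k)) = - (D (Suc k) * w k)"
      proof -
        have "E k n * (E (Suc k) n * w k) = (D (Suc k) + (r * s) \<star> (E (Suc k) n * E k n)) * w k"
          by (simp add: D_def br_def mult.assoc)
        also have "\<dots> = D (Suc k) * w k + (r * s) \<star> (E (Suc k) n * (E k n * w k))"
          by (simp add: expand)
        also have "\<dots> = D (Suc k) * w k + (r * s * inverse RR) \<star> (E (Suc k) n * w k * E k n)"
          using qcD[OF b] by (simp add: expand)
        finally show ?thesis using 5 by (simp add: br_def expand)
      qed
      show "qc (SS * inverse RR) (E k j) (- (D (Suc k) * w k))"
        using qc_mult[OF a b] 5 by (auto intro!: qc_uminus)
      show "1 \<noteq> r * s * inverse RR" "r * s * inverse RR \<noteq> SS * inverse RR" "1 \<noteq> SS * inverse RR"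
        using squares_ne r_ne_s r_nz s_nz by (auto simp: field_simps RR_def SS_def)
    qed (auto simp: power_mult_distrib power_inverse r_root s_root)
  qed
qed

theorem E_power_commutes:
  assumes "1 \<le> k" "k \<le> j" "j \<le> n"
  shows "\<forall>i\<in>{1..n}. qc 1 (E k j ^ l) (e i) \<and> qc 1 (E k j ^ l) (f i)
    \<and> qc 1 (E k j ^ l) (w i) \<and> qc 1 (E k j ^ l) (w' i)"
proof (rule row_commutes)
  show "k \<in> {1..n}" using assms by simp
  show f: "qc 1 (E k j ^ l) (f i)" if "i \<in> {1..n}" for i
    using E_power_f assms that by blast
  show "qc 1 (E k j ^ l) (w i)" if "i \<in> {1..n}" for i
    using assms that by (intro qcr_power qcr_E torus_qcr) auto
  show w': "qc 1 (E k j ^ l) (w' i)" if "i \<in> {1..n}" for i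
    using assms that by (intro qcr_power qcr_E torus_qcr) auto
  show "qc 1 (E k j ^ l) (E' m (Suc m))" if "k = Suc m" "1 \<le> m" for m
    using assms that by (intro qcr_power qcr_E top_qcr) auto
  have comm: "qc 1 (E k j ^ l) (e i)" if "qc 1 (e i) (E k j)" for i
    using qc_power_left[OF qc_1_sym[OF that], of l] by simp
  show "qc 1 (E k j ^ l) (e i)" if "1 \<le> i" "Suc i < k" for i
    using comm E_far[of k j i] assms that by auto
  show "qc 1 (E k j ^ l) (e i)" if i: "k \<le> i" "i \<le> n" for i
  proof -
    consider "i = k" | "k < i" "i < j" | "k < i" "i = j" "j < n" | "k < i" "i = j" "j = n"
      | "i = Suc j" | "i > Suc j"
      using i assms by linarith
    then show ?thesis
    proof cases
      case 1
      \<comment> \<open>A power commutes with its own base, which starts the descent to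
        \<open>e k\<close>.\<close>
      have "qc 1 (E k j ^ l) (E k j)" by (simp add: qc_1 power_commutes)
      then have "qc 1 (E k j ^ l) (e k)"
        using assms f w' by (intro descend_E[of _ k j]) auto
      then show ?thesis using 1 by simp
    next
      case 2
      then show ?thesis using comm E_mid[of k i j] assms by auto
    next
      case 3
      then obtain q where "j = Suc q" "k \<le> q" by (cases j) auto
      then show ?thesis using 3 E_last[of k q] assms by (auto intro!: qcr_power_left qcrI[of SS])
    next
      case 4
      show ?thesis
      proof (rule power_commute_br2)
        show "br (r * s) (E k j) (e i) = E' k n" using 4 assms by (simp add: E'_n)
        show "qc SS (E k j) (E' k n)" using adjacent_E_E'[of k] 4 assms by simp
        show "r * s \<noteq> SS" using r_ne_s s_nz by (simp add: SS_def)
      qed simp_all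
    next
      case 5
      show ?thesis
      proof (rule power_commute_br2)
        show "br RR (E k j) (e i) = E k (Suc j)" using 5 that assms by (simp add: E_right)
        show "qc SS (E k j) (E k (Suc j))" using adjacent_E[of k j] 5 that assms by simp
      qed (use squares_ne in auto)
    next
      case 6
      then show ?thesis using comm E_far[of k j i] assms that by auto
    qed
  qed
qed

text \<open>The commutator of \<open>E' k j\<close> with \<open>G k (j - 1 - k)\<close> is a polynomial in \<open>e\<^sub>j, \<dots>, e\<^sub>n\<close> times
  \<open>Om k (j - 1 - k)\<close>, and \<open>E' k j\<close> \<open>q\<close>-commutes with both factors.\<close>

primrec G where
  "G k 0 = f k"
| "G k (Suc t) = br SS (f (k + Suc t)) (G k t)"

primrec Om where
  "Om k 0 = w k"
| "Om k (Suc t) = w (k + Suc t) * Om k t"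

text \<open>Of the factors of \<open>Om k t\<close>, only \<open>w (k + t)\<close> is adjacent to
  the index of this \<open>f\<close>.\<close>

lemma Om_f:
  assumes "1 \<le> k" "k + t < n"
  shows "qc (inverse SS) (Om k t) (f (Suc (k + t)))"
proof -
  have far: "m \<le> n \<Longrightarrow> k + t + 1 < m \<Longrightarrow> k + t < n \<Longrightarrow> qc 1 (Om k t) (f m)" for m t
  proof (induction t)
    case 0
    then show ?case using w_f[of m k] pairing_far[of m k] assms by auto
  next
    case (Suc t)
    then show ?case
      using w_f[of m "k + Suc t"] pairing_far[of m "k + Suc t"] assms
        qc_mult_left[of 1 "w (k + Suc t)" "f m" 1 "Om k t"] by auto
  qed
  have down: "qc (inverse SS) (w (k + t)) (f (Suc (k + t)))"
    using w_f[of "Suc (k + t)" "k + t"] assms by (simp add: pairing_down)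
  show ?thesis
  proof (cases t)
    case 0
    then show ?thesis using down by simp
  next
    case (Suc q)
    then show ?thesis
      using down far[of "Suc (k + t)" q] assms
        qc_mult_left[of "inverse SS" "w (k + t)" "f (Suc (k + t))" 1 "Om k q"] by simp
  qed
qed

lemma Om_E':
  assumes "1 \<le> k" "j \<le> n"
  shows "Suc (k + t) < j \<Longrightarrow> qc RR (Om k t) (E' k j)"
    and "Suc (k + t) = j \<Longrightarrow> qc (RR * SS) (Om k t) (E' k j)"
proof -
  show before: "qc RR (Om k t) (E' k j)" if "Suc (k + t) < j" for t
    using that
  proof (induction t)
    case 0
    then show ?case using w_E'_first[of k j] assms by simp
  next
    case (Suc t)
    then show ?case
      using w_E'_before(1)[of k "k + Suc t" j] assms
        qc_mult_left[of 1 "w (k + Suc t)" "E' k j" RR "Om k t"] by simp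
  qed
  show "qc (RR * SS) (Om k t) (E' k j)" if "Suc (k + t) = j"
  proof (cases t)
    case 0
    then show ?thesis using w_E'_top[of k] that assms by auto
  next
    case (Suc q)
    have "qc SS (w (k + t)) (E' k j)"
      using w_E'_Suc(1)[of k "k + t"] that Suc assms by auto
    then show ?thesis
      using before[of q] that Suc qc_mult_left[of SS "w (k + t)" "E' k j" RR "Om k q"]
      by (simp add: mult.commute)
  qed
qed

text \<open>The scalar of \<open>W\<close> against \<open>f m\<close> cancels the \<open>SS\<close>
  of the bracket, which therefore collapses to the plain commutator of \<open>E' m j\<close> with
  \<open>f m\<close>.\<close>

lemma E'_G_step:
  assumes "1 \<le> k" "k < m" "m < j" "j \<le> n"
    and g: "br 1 (E' k j) g = c \<star> (E' m j * W)" and W: "qc (inverse SS) W (f m)"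
  shows "br 1 (E' k j) (br SS (f m) g) = (- c) \<star> (br 1 (E' m j) (f m) * W)"
proof -
  have "br 1 (E' k j) (f m) = 0" using E'_f_other[of k j m] assms by (simp add: br_eq_0_iff)
  then have "br 1 (E' k j) (br SS (f m) g) = c \<star> br SS (f m) (E' m j * W)"
    by (simp add: br_derivation_right g br_scale)
  also have "br SS (f m) (E' m j * W) = f m * E' m j * W - SS \<star> (E' m j * (W * f m))"
    by (simp add: br_def mult.assoc)
  also have "\<dots> = - (br 1 (E' m j) (f m) * W)"
    unfolding qcD[OF W] by (simp add: br_def expand)
  finally show ?thesis by simp
qed

lemma E'_G:
  assumes "1 \<le> k" "j \<le> n"
  shows "Suc (k + t) < j \<Longrightarrow> \<exists>c. br 1 (E' k j) (G k t) = c \<star> (E' (Suc (k + t)) j * Om k t)"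
proof (induction t)
  case 0
  then show ?case using E'_f_first[of k j] assms by (intro exI[of _ "- 1"]) simp
next
  case (Suc t)
  then obtain c where c: "br 1 (E' k j) (G k t) = c \<star> (E' (Suc (k + t)) j * Om k t)" by auto
  have "br 1 (E' k j) (G k (Suc t)) = (- c) \<star> (br 1 (E' (Suc (k + t)) j) (f (Suc (k + t))) * Om k t)"
    using E'_G_step[OF _ _ _ _ c Om_f] Suc.prems assms by simp
  also have "br 1 (E' (Suc (k + t)) j) (f (Suc (k + t))) = - (E' (Suc (Suc (k + t))) j * w (Suc (k + t)))"
    using E'_f_first[of "Suc (k + t)" j] Suc.prems assms by simp
  finally have "br 1 (E' k j) (G k (Suc t)) = c \<star> (E' (Suc (k + Suc t)) j * Om k (Suc t))"
    by (simp add: mult.assoc)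
  then show ?case by blast
qed

text \<open>The iterated bracket moves down the rows until \<open>E'_f_top\<close> ends it. This is
  a chain of length two with scalars 1 and \<open>SS * inverse RR\<close>.\<close>

lemma E'_power_G:
  assumes "1 \<le> k" "j \<le> n" "Suc (k + t) = j"
  shows "qc 1 (E' k j ^ l) (G k t)"
proof -
  obtain P where P: "br 1 (E' (k + t) j) (f (k + t)) = P * w (k + t)" "qc (SS * SS) (E' k j) P"
    using E'_f_top[of "k + t"] assms by (metis le_add1 le_trans)
  have "\<exists>c. br 1 (E' k j) (G k t) = c \<star> (P * Om k t)"
  proof (cases t)
    case 0
    then show ?thesis using P by (intro exI[of _ 1]) simp
  next
    case (Suc q)
    obtain c where c: "br 1 (E' k j) (G k q) = c \<star> (E' (k + t) j * Om k q)"
      using E'_G[of k j q] assms Suc by auto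
    have "br 1 (E' k j) (G k t) = (- c) \<star> (br 1 (E' (k + t) j) (f (k + t)) * Om k q)"
      using E'_G_step[OF _ _ _ _ c] Om_f[of k q] assms Suc by simp
    also have "\<dots> = (- c) \<star> (P * Om k t)"
      unfolding P(1) using Suc by (simp add: mult.assoc)
    finally show ?thesis by blast
  qed
  then obtain c where c: "br 1 (E' k j) (G k t) = c \<star> (P * Om k t)" by blast
  have "qc (inverse (RR * SS)) (E' k j) (Om k t)"
    using assms by (intro qc_sym[OF Om_E'(2)]) (auto simp: field_simps)
  then have "qc (SS * SS * inverse (RR * SS)) (E' k j) (c \<star> (P * Om k t))"
    using P(2) by (intro qc_scale qc_mult)
  then show ?thesis
    by (intro power_commute_br2[OF c, of "SS * SS * inverse (RR * SS)"])
      (use squares_ne in \<open>auto simp: field_simps power_mult_distrib power_inverse\<close>)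
qed

text \<open>Only the outer letter of \<open>G k (Suc t)\<close> interacts with this
  \<open>e\<close>, and the \<open>w'\<close> part vanishes in \<open>br_torus_left\<close>. The
  factor \<open>1 \<star>\<close> is the shape that \<open>qc_1_right_cancel\<close> takes.\<close>

lemma e_G:
  assumes "1 \<le> k" "k + Suc t < n"
  shows "br 1 (e (k + Suc t)) (G k (Suc t)) = 1 \<star> (G k t * w (k + Suc t))"
proof -
  have far: "k + q < m \<Longrightarrow> m < n \<Longrightarrow> qc 1 (e m) (G k q)" for q m
  proof (induction q)
    case 0
    then show ?case using e_f_comm[of m k] assms by auto
  next
    case (Suc q)
    then show ?case using e_f_comm[of m "k + Suc q"] assms by (auto intro!: qc_br_1)
  qed
  have wfar: "k + q + 1 < m \<Longrightarrow> m < n \<Longrightarrow> qc 1 (w m) (G k q) \<and> qc 1 (w' m) (G k q)" for q m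
  proof (induction q)
    case 0
    then show ?case using w_f[of k m] w'_f[of k m] pairing_far[of k m] pairing_far[of m k] assms by auto
  next
    case (Suc q)
    then show ?case
      using w_f[of "k + Suc q" m] w'_f[of "k + Suc q" m] pairing_far[of "k + Suc q" m]
        pairing_far[of m "k + Suc q"] assms
      by (auto intro!: qc_br_1)
  qed
  define m where "m = k + Suc t"
  have m: "m = Suc (k + t)" "m \<in> {1..n}" "m < n" using assms by (auto simp: m_def)
  have base: "qc RR (w m) (f (k + t))" "qc SS (w' m) (f (k + t))"
    using w_f[of "k + t" m] w'_f[of "k + t" m] assms m by (auto simp: pairing_up pairing_down)
  have w: "qc RR (w m) (G k t)" "qc SS (w' m) (G k t)"
    using base wfar[of _ m] m by (cases t; auto intro!: qc_br_2)+
  have "br 1 (e m) (G k t) = 0" using far[of t m] m by (simp add: br_eq_0_iff)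
  then have "br 1 (e m) (G k (Suc t)) = br SS (eta m \<star> (w m - w' m)) (G k t)"
    using m e_f_same[of m] by (simp add: br_derivation_right)
  also have "\<dots> = (eta m * (RR - SS)) \<star> (G k t * w m)"
    using br_torus_left[OF w, of SS] by simp
  finally show ?thesis using eta_RR[of m] m by (simp add: m_def)
qed

lemma descend_G:
  assumes "\<And>i. i \<in> {1..n} \<Longrightarrow> qc 1 X (w i)" "\<And>i. k < i \<Longrightarrow> i \<le> n \<Longrightarrow> qc 1 X (e i)" "1 \<le> k"
  shows "k + t < n \<Longrightarrow> qc 1 X (G k t) \<Longrightarrow> qc 1 X (f k)"
proof (induction t)
  case (Suc t)
  have "qc 1 X (br 1 (e (k + Suc t)) (G k (Suc t)))"
    using Suc.prems assms by (intro qc_br_1) auto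
  then have "qc 1 X (1 \<star> (G k t * w (k + Suc t)))"
    using e_G[of k t] Suc.prems assms by simp
  then have "qc 1 X (G k t)"
    using Suc.prems assms w_inverse(1)[of "k + Suc t"]
    by (intro qc_1_right_cancel[of X 1 "G k t" "w (k + Suc t)"]) auto
  then show ?case using Suc by simp
qed simp

text \<open>The order matters: first the \<open>f i\<close> with \<open>i \<noteq> k\<close>, then
  the \<open>e i\<close> with \<open>i \<ge> k\<close>, where \<open>e k\<close> is reached by
  descent using those \<open>f i\<close>. Then \<open>f k\<close> is reached by descent from
  \<open>G\<close> using the \<open>e i\<close> with \<open>i > k\<close>, and finally the
  \<open>e i\<close> with \<open>i < k\<close>.\<close>

theorem E'_power_commutes:
  assumes "1 \<le> k" "k < j" "j \<le> n"
  shows "\<forall>i\<in>{1..n}. qc 1 (E' k j ^ l) (e i) \<and> qc 1 (E' k j ^ l) (f i)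
    \<and> qc 1 (E' k j ^ l) (w i) \<and> qc 1 (E' k j ^ l) (w' i)"
proof -
  define X where "X = E' k j ^ l"
  have w: "qc 1 X (w i)" "qc 1 X (w' i)" if "i \<in> {1..n}" for i
    unfolding X_def using assms that by (auto intro!: qcr_power qcr_E' torus_qcr)
  have T: "qc 1 X (E' m (Suc m))" if "k = Suc m" "1 \<le> m" for m
    unfolding X_def using assms that by (intro qcr_power qcr_E' top_qcr) auto
  have comm: "qc 1 X (e i)" if "qc 1 (e i) (E' k j)" for i
    using qc_power_left[OF qc_1_sym[OF that], of l] by (simp add: X_def)
  have f_j: "qc 1 X (f j)"
  proof -
    obtain c where c: "br 1 (E' k j) (f j) = c \<star> (pv k j * w' j)"
      by (rule E'_f_last[OF assms])
    have "qc (RR * inverse SS) (E' k j) (pv k j * w' j)"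
    proof (cases "j = n")
      case True
      have "qc (inverse SS) (E' k n) (E k n)" using qc_sym[OF adjacent_E_E'[of k]] True assms by simp
      moreover have "qc RR (E' k n) (w' n)" using qc_sym[OF w'_E'_n[of k]] True assms by simp
      ultimately show ?thesis using True qc_mult by (fastforce simp: pv_def mult.commute)
    next
      case False
      have "qc RR (E' k j) (E' k (Suc j))" using qc_sym[OF adjacent_E'[of k j]] False assms by simp
      moreover have "qc (inverse SS) (E' k j) (w' j)" using qc_sym[OF w'_E'_last[of k j]] False assms by simp
      ultimately show ?thesis using False qc_mult by (fastforce simp: pv_def)
    qed
    then show ?thesis
      unfolding X_def by (intro power_commute_br2[OF c qc_scale])
        (use squares_ne in \<open>auto simp: field_simps power_mult_distrib power_inverse\<close>)
  qed
  have f: "qc 1 X (f i)" if "i \<in> {1..n}" "i \<noteq> k" for i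
    using f_j E'_f_other[of k j i] that assms qc_power_left[of 1 "E' k j" "f i" l]
    by (cases "i = j") (auto simp: X_def)
  have e: "qc 1 X (e i)" if i: "k \<le> i" "i \<le> n" for i
  proof -
    consider "i = k" | "k < i" "Suc i < j" | "k < i" "Suc i = j" | "i = j" "j < n" | "i = j" "j = n"
      | "j < i" "i < n" | "j < i" "i = n"
      using i assms by linarith
    then show ?thesis
    proof cases
      case 1
      have "qc 1 X (E' k j)" by (simp add: X_def qc_1 power_commutes)
      then have "qc 1 X (e k)"
        using assms f w by (intro descend_E'[of _ k j]) auto
      then show ?thesis using 1 by simp
    next
      case 2
      then show ?thesis using comm E'_before[of k i j] assms by auto
    next
      case 3
      show ?thesis
        unfolding X_def
      proof (rule power_commute_br2)
        show "br (inverse SS) (E' k j) (e i) = E' k i" using 3 assms E'_step[of k i] by auto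
        show "qc (inverse RR) (E' k j) (E' k i)" using adjacent_E'[of k i] 3 assms by auto
      qed (use squares_ne in \<open>auto simp: power_inverse\<close>)
    next
      case 4
      then show ?thesis using E'_last[of k j] assms
        by (auto simp: X_def power_inverse intro!: qcr_power_left qcrI[of "inverse RR"])
    next
      case 5
      then show ?thesis using E'_n_last[of k] assms
        by (auto simp: X_def intro!: qcr_power_left qcrI[of SS])
    next
      case 6
      then show ?thesis using comm E'_after[of k j i] assms by auto
    next
      case 7
      then show ?thesis using E'_after_n[of k j] assms
        by (auto simp: X_def power_mult_distrib intro!: qcr_power_left qcrI[of "RR * SS"])
    qed
  qed
  have "qc 1 X (f k)"
  proof (rule descend_G)
    show "qc 1 X (G k (j - Suc k))" unfolding X_def using assms by (intro E'_power_G) auto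
  qed (use w e assms in auto)
  then have f': "qc 1 X (f i)" if "i \<in> {1..n}" for i using f that by (cases "i = k") auto
  have e': "qc 1 X (e i)" if "1 \<le> i" "Suc i < k" for i
  proof (rule comm)
    have "qc 1 (e i) (E k n)" "qc 1 (e i) (e m)" if "k \<le> m" "m \<le> n" for m
      using E_far[of k n i] e_comm[of i m] \<open>1 \<le> i\<close> \<open>Suc i < k\<close> that assms by auto
    note far = this
    show "qc 1 (e i) (E' k j)"
      using assms(3)
    proof (induction rule: inc_induct)
      case base
      then show ?case using far[of n] assms by (auto simp: E'_n intro!: qc_br_1)
    next
      case (step m)
      then show ?case using far[of m] assms by (auto simp: E'_step[of k m] intro!: qc_br_1)
    qed
  qed
  show ?thesis
    using row_commutes[of k X, OF _ w f' e e' T] assms by (simp add: X_def)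
qed

text \<open>In the opposite algebra \<open>w\<close> and \<open>w'\<close> are exchanged, so this
  statement also yields the powers of \<open>w' k\<close>.\<close>

theorem w_power_commutes:
  assumes "k \<in> {1..n}"
  shows "\<forall>i\<in>{1..n}. qc 1 (w k ^ l) (e i) \<and> qc 1 (w k ^ l) (f i) \<and> qc 1 (w k ^ l) (w i) \<and> qc 1 (w k ^ l) (w' i)"
proof
  fix i assume i: "i \<in> {1..n}"
  have "qcr (w k) (e i)" "qcr (w k) (f i)"
    using torus_qcr[of k i] w_f[of i k] assms i by (auto intro!: qcrI simp: power_inverse)
  moreover have "qcr (w k) (w i)" "qcr (w k) (w' i)"
    using w_w[of k i] w_w'[of k i] assms i by (auto intro!: qcrI[of 1] simp: qc_1)
  ultimately show "qc 1 (w k ^ l) (e i) \<and> qc 1 (w k ^ l) (f i) \<and> qc 1 (w k ^ l) (w i) \<and> qc 1 (w k ^ l) (w' i)"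
    by (simp add: qcr_power_left)
qed

end

section \<open>The algebra as a factor of a ring type\<close>

lemma ideal_gen_uminus: "x \<in> ideal_gen J \<Longrightarrow> - x \<in> ideal_gen J"
  using ideal_gen.mult[of x J "- 1" 1] by simp

lemma ideal_gen_diff: "x \<in> ideal_gen J \<Longrightarrow> y \<in> ideal_gen J \<Longrightarrow> x - y \<in> ideal_gen J"
  using ideal_gen.add[OF _ ideal_gen_uminus] by fastforce

lemma ideal_gen_mult_left: "x \<in> ideal_gen J \<Longrightarrow> a * x \<in> ideal_gen J"
  using ideal_gen.mult[of x J a 1] by simp

lemma ideal_gen_mult_right: "x \<in> ideal_gen J \<Longrightarrow> x * b \<in> ideal_gen J"
  using ideal_gen.mult[of x J 1 b] by simp

text \<open>Makes the product of all quotients nontrivial: its factor at the empty set is the ring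
  itself.\<close>

lemma ideal_gen_empty: "x \<in> ideal_gen {} \<Longrightarrow> x = 0"
  by (induction rule: ideal_gen.induct) auto

lemma ideal_gen_cong:
  assumes "a - a' \<in> ideal_gen J"
  shows "- a - - a' \<in> ideal_gen J"
    and "b - b' \<in> ideal_gen J \<Longrightarrow> (a + b) - (a' + b') \<in> ideal_gen J"
    and "b - b' \<in> ideal_gen J \<Longrightarrow> (a - b) - (a' - b') \<in> ideal_gen J"
    and "b - b' \<in> ideal_gen J \<Longrightarrow> a * b - a' * b' \<in> ideal_gen J"
proof -
  have eqs: "- a - - a' = - (a - a')" "(a + b) - (a' + b') = (a - a') + (b - b')"
    "(a - b) - (a' - b') = (a - a') - (b - b')" "a * b - a' * b' = (a - a') * b + a' * (b - b')"
    by (simp_all add: algebra_simps)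
  show "- a - - a' \<in> ideal_gen J"
    unfolding eqs using assms by (rule ideal_gen_uminus)
  assume b: "b - b' \<in> ideal_gen J"
  show "(a + b) - (a' + b') \<in> ideal_gen J"
    unfolding eqs using assms b by (rule ideal_gen.add)
  show "(a - b) - (a' - b') \<in> ideal_gen J"
    unfolding eqs using assms b by (rule ideal_gen_diff)
  show "a * b - a' * b' \<in> ideal_gen J"
    unfolding eqs using assms b by (intro ideal_gen.add ideal_gen_mult_left ideal_gen_mult_right)
qed

text \<open>A type cannot depend on the ideal, so all quotients of the ring by ideals \<open>ideal_gen J\<close> are
  collected into one ring, their product over all \<open>J\<close>.\<close>

quotient_type (overloaded) 'b all_quotients = "'b::ring_1 set \<Rightarrow> 'b" / "\<lambda>g h. \<forall>J. g J - h J \<in> ideal_gen J"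
proof (rule equivpI)
  show "reflp (\<lambda>g h. \<forall>J. g J - h J \<in> ideal_gen J)"
    by (rule reflpI) (simp add: ideal_gen.zero)
  show "symp (\<lambda>g h. \<forall>J. g J - h J \<in> ideal_gen J)"
    by (rule sympI) (metis ideal_gen_uminus minus_diff_eq)
  show "transp (\<lambda>g h. \<forall>J. g J - h J \<in> ideal_gen J)"
    by (rule transpI) (metis ideal_gen.add diff_add_cancel add_diff_eq)
qed

instantiation all_quotients :: (ring_1) ring_1
begin

lift_definition zero_all_quotients :: "'a all_quotients" is "\<lambda>J. 0" .
lift_definition one_all_quotients :: "'a all_quotients" is "\<lambda>J. 1" .
lift_definition uminus_all_quotients :: "'a all_quotients \<Rightarrow> 'a all_quotients" is "\<lambda>g J. - g J"
  using ideal_gen_cong(1) by blast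
lift_definition plus_all_quotients :: "'a all_quotients \<Rightarrow> 'a all_quotients \<Rightarrow> 'a all_quotients"
  is "\<lambda>g h J. g J + h J"
  using ideal_gen_cong(2) by blast
lift_definition minus_all_quotients :: "'a all_quotients \<Rightarrow> 'a all_quotients \<Rightarrow> 'a all_quotients"
  is "\<lambda>g h J. g J - h J"
  using ideal_gen_cong(3) by blast
lift_definition times_all_quotients :: "'a all_quotients \<Rightarrow> 'a all_quotients \<Rightarrow> 'a all_quotients"
  is "\<lambda>g h J. g J * h J"
  using ideal_gen_cong(4) by blast

instance
proof
  show "(0 :: 'a all_quotients) \<noteq> 1"
  proof (transfer, rule notI)
    assume "\<forall>J. (0 :: 'a) - 1 \<in> ideal_gen J"
    then have "(0 :: 'a) - 1 = 0" using ideal_gen_empty by blast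
    then show False by simp
  qed
qed (transfer, simp add: ideal_gen.zero algebra_simps)+

end

lift_definition quot :: "'b::ring_1 set \<Rightarrow> 'b \<Rightarrow> 'b all_quotients" is "\<lambda>J x K. if K = J then x else 0" .

lemma quot_diff: "quot J (x - y) = quot J x - quot J y"
  by transfer (simp add: ideal_gen.zero)

lemma quot_mult: "quot J (x * y) = quot J x * quot J y"
  by transfer (simp add: ideal_gen.zero)

lemma quot_eq_iff: "quot J x = quot J y \<longleftrightarrow> x - y \<in> ideal_gen J"
  by transfer (auto simp: ideal_gen.zero)

lemma quot_0: "quot J 0 = 0"
  by transfer (simp add: ideal_gen.zero)

text \<open>The exponent must be positive because \<open>quot J 1\<close> is the idempotent of one
  factor and not the unit of the product.\<close>

lemma quot_power: "m > 0 \<Longrightarrow> quot J (x ^ m) = quot J x ^ m"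
proof (induction m)
  case (Suc m)
  then show ?case by (cases m) (simp_all add: quot_mult)
qed simp

lift_definition diag :: "'b::ring_1 \<Rightarrow> 'b all_quotients" is "\<lambda>x J. x" .

lemma diag_add: "diag (x + y) = diag x + diag y"
  by transfer (simp add: ideal_gen.zero)

lemma diag_mult: "diag (x * y) = diag x * diag y"
  by transfer (simp add: ideal_gen.zero)

lemma diag_1: "diag 1 = 1"
  by transfer (simp add: ideal_gen.zero)

lemma diag_mult_quot: "quot J (x * y) = diag x * quot J y"
  by transfer (simp add: ideal_gen.zero)

lemma diag_central:
  assumes "\<And>y. x * y = y * x"
  shows "diag x * z = z * diag x"
  using assms by transfer (simp add: ideal_gen.zero)

text \<open>The embedding of one quotient is not unital. The images of units are completed by
  \<open>1 - quot J 1\<close> so that they become units of the product ring.\<close>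

definition quot1 :: "'b::ring_1 set \<Rightarrow> 'b \<Rightarrow> 'b all_quotients" where
  "quot1 J x = quot J x + (1 - quot J 1)"

lemma quot1_mult_quot: "quot1 J x * quot J y = quot J (x * y)"
  unfolding quot1_def by (simp add: algebra_simps flip: quot_mult)

lemma quot_mult_quot1: "quot J x * quot1 J y = quot J (x * y)"
  unfolding quot1_def by (simp add: algebra_simps flip: quot_mult)

lemma quot1_mult: "quot1 J x * quot1 J y = quot1 J (x * y)"
  unfolding quot1_def by (simp add: algebra_simps flip: quot_mult)

lemma quot1_1: "quot1 J 1 = 1"
  by (simp add: quot1_def)

lemma quot1_power: "quot1 J (x ^ m) = quot1 J x ^ m"
  by (induction m) (simp_all add: quot1_1 flip: quot1_mult)

lemma quot1_eq_iff: "quot1 J x = quot1 J y \<longleftrightarrow> x - y \<in> ideal_gen J"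
  by (simp add: quot1_def quot_eq_iff)

text \<open>A separate type, since the reversed multiplication needs its own ring instance.\<close>

datatype 'a opposite = Op (unop: 'a)

instantiation opposite :: (ring_1) ring_1
begin
definition "0 = Op 0"
definition "1 = Op 1"
definition "- x = Op (- unop x)"
definition "x + y = Op (unop x + unop y)"
definition "x - y = Op (unop x - unop y)" for x y :: "'a opposite"
definition "x * y = Op (unop y * unop x)"
instance
  by standard (simp_all add: zero_opposite_def one_opposite_def uminus_opposite_def plus_opposite_def
      minus_opposite_def times_opposite_def algebra_simps)
end

lemmas Op_simps = zero_opposite_def one_opposite_def uminus_opposite_def plus_opposite_def
  minus_opposite_def times_opposite_def

lemma Op_power: "Op x ^ m = Op (x ^ m)"
  by (induction m) (simp_all add: Op_simps power_commutes)

lemma opposite_scalar_algebra: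
  assumes "scalar_algebra scale"
  shows "scalar_algebra (\<lambda>c x. Op (scale c (unop x)))"
proof -
  interpret scalar_algebra scale by fact
  show ?thesis
    by standard (simp_all add: Op_simps expand)
qed

section \<open>The free algebra and its scalars\<close>

lemma free_algebra_induct [case_names add scalar gen]:
  fixes x :: "'k::field freealg"
  assumes add: "\<And>x y. P x \<Longrightarrow> P y \<Longrightarrow> P (x + y)" and scalar: "\<And>c. P (sc c)"
    and mult: "\<And>g x. P x \<Longrightarrow> P (gn g * x)"
  shows "P x"
proof -
  have single: "P (Poly_Mapping.single (Word gs) c)" for gs c
  proof (induction gs)
    case Nil
    show ?case using scalar by (simp add: sc_def)
  next
    case (Cons g gs)
    have "Poly_Mapping.single (Word (g # gs)) c = gn g * Poly_Mapping.single (Word gs) c"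
      by (simp add: gn_def mult_single)
    then show ?case using mult[OF Cons] by simp
  qed
  show ?thesis
  proof (induction x rule: update_induct)
    case const
    show ?case using scalar[of 0] by (simp add: sc_def)
  next
    case (update f a b)
    have "Poly_Mapping.update a b f = f + Poly_Mapping.single a b"
      using update by (intro poly_mapping_eqI) (auto simp: lookup_update lookup_add lookup_single in_keys_iff when_def)
    then show ?case using add[OF update(3) single] by (cases a) simp
  qed
qed

lemma sc_add: "sc (a + b) = sc a + sc b"
  by (simp add: sc_def single_add)

lemma sc_mult: "sc (a * b) = sc a * sc b"
  by (simp add: sc_def mult_single)

lemma sc_1: "sc 1 = 1"
  using single_one[where 'a = word] by (simp add: sc_def zero_word_def)

lemma sc_gn: "sc c * gn g = gn g * sc c"
  by (simp add: sc_def gn_def mult_single)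

lemma sc_central:
  fixes x :: "'k::field freealg"
  shows "sc c * x = x * sc c"
proof (induction x rule: free_algebra_induct)
  case (add x y)
  then show ?case by (simp add: algebra_simps)
next
  case (scalar d)
  show ?case by (simp add: mult.commute flip: sc_mult)
next
  case (gen g x)
  have "sc c * (gn g * x) = gn g * (sc c * x)" by (simp add: sc_gn flip: mult.assoc)
  then show ?case using gen by (simp add: mult.assoc)
qed

text \<open>Scalars act through the diagonal and not through one factor, so that the scalar 1 acts
  as the identity on the whole product.\<close>

definition quot_scale :: "'k::field \<Rightarrow> 'k freealg all_quotients \<Rightarrow> 'k freealg all_quotients" where
  "quot_scale c x = diag (sc c) * x"

lemma quot_scalar_algebra: "scalar_algebra (quot_scale :: 'k::field \<Rightarrow> _)"
proof
  fix a b :: 'k and x y :: "'k freealg all_quotients"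
  show "x * quot_scale a y = quot_scale a (x * y)"
    unfolding quot_scale_def using diag_central[OF sc_central, of a x] by (simp flip: mult.assoc)
qed (simp_all add: quot_scale_def sc_add sc_mult sc_1 diag_add diag_mult diag_1 algebra_simps)

lemma quot_sc_mult: "quot J (sc c * x) = quot_scale c (quot J x)"
  by (simp add: quot_scale_def diag_mult_quot)

section \<open>Centrality from the generators\<close>

text \<open>Commuting modulo an ideal is preserved by sums and products. Generators with an index
  out of range are relators themselves.\<close>

lemma Ucentral_if_generators:
  assumes "\<And>g. gen_idx g \<in> {1..n} \<Longrightarrow> x * gn g - gn g * x \<in> ideal_gen (rels n r s)"
  shows "Ucentral n r s x"
  unfolding Ucentral_def
proof
  fix y
  have g: "x * gn g - gn g * x \<in> ideal_gen (rels n r s)" for g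
  proof (cases "gen_idx g \<in> {1..n}")
    case False
    then have "gn g \<in> rels n r s" by (auto simp: rels_def)
    then have "gn g \<in> ideal_gen (rels n r s)" by (rule ideal_gen.base)
    then show ?thesis by (intro ideal_gen_diff ideal_gen_mult_left ideal_gen_mult_right)
  qed (rule assms)
  show "x * y - y * x \<in> ideal_gen (rels n r s)"
  proof (induction y rule: free_algebra_induct)
    case (add y z)
    have "x * (y + z) - (y + z) * x = (x * y - y * x) + (x * z - z * x)" by (simp add: algebra_simps)
    then show ?case using ideal_gen.add[OF add] by simp
  next
    case (scalar c)
    show ?case by (simp add: sc_central ideal_gen.zero)
  next
    case (gen h y)
    have "x * (gn h * y) - gn h * y * x = (x * gn h - gn h * x) * y + gn h * (x * y - y * x)"
      by (simp add: algebra_simps)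
    then show ?case using g gen by (simp add: ideal_gen.add ideal_gen_mult_left ideal_gen_mult_right)
  qed
qed

lemma commute_inverse:
  fixes a b c :: "'a::monoid_mult"
  assumes "a * b = b * a" "b * c = 1" "c * b = 1"
  shows "a * c = c * a"
proof -
  have "c * a = c * (a * b) * c" using assms(2) by (simp add: mult.assoc)
  also have "\<dots> = c * b * a * c" using assms(1) by (simp add: mult.assoc)
  finally show ?thesis using assms(3) by simp
qed

section \<open>The defining relations in the product ring\<close>

lemma quot_rels: "x \<in> rels n r s \<Longrightarrow> quot (rels n r s) x = 0"
  using quot_eq_iff[of "rels n r s" x 0] by (simp add: quot_0 ideal_gen.base)

lemma quot1_rels: "x - y \<in> rels n r s \<Longrightarrow> quot1 (rels n r s) x = quot1 (rels n r s) y"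
  by (simp add: quot1_eq_iff ideal_gen.base)

lemma torus_inverses:
  assumes "i \<in> {1..n}"
  shows "quot1 (rels n r s) (gw i) * quot1 (rels n r s) (gwi i) = 1"
    "quot1 (rels n r s) (gwi i) * quot1 (rels n r s) (gw i) = 1"
    "quot1 (rels n r s) (gw' i) * quot1 (rels n r s) (gw'i i) = 1"
    "quot1 (rels n r s) (gw'i i) * quot1 (rels n r s) (gw' i) = 1"
proof -
  have "gw i * gwi i - 1 \<in> rels n r s" "gwi i * gw i - 1 \<in> rels n r s"
    "gw' i * gw'i i - 1 \<in> rels n r s" "gw'i i * gw' i - 1 \<in> rels n r s"
    unfolding rels_def using assms by blast+
  then show "quot1 (rels n r s) (gw i) * quot1 (rels n r s) (gwi i) = 1"
    "quot1 (rels n r s) (gwi i) * quot1 (rels n r s) (gw i) = 1"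
    "quot1 (rels n r s) (gw' i) * quot1 (rels n r s) (gw'i i) = 1"
    "quot1 (rels n r s) (gw'i i) * quot1 (rels n r s) (gw' i) = 1"
    by (simp_all add: quot1_mult quot1_1 quot1_rels[where y = 1])
qed

lemma torus_commutes:
  assumes "i \<in> {1..n}" "j \<in> {1..n}"
  shows "quot1 (rels n r s) (gw i) * quot1 (rels n r s) (gw j) = quot1 (rels n r s) (gw j) * quot1 (rels n r s) (gw i)"
    "quot1 (rels n r s) (gw i) * quot1 (rels n r s) (gw' j) = quot1 (rels n r s) (gw' j) * quot1 (rels n r s) (gw i)"
    "quot1 (rels n r s) (gw' i) * quot1 (rels n r s) (gw' j) = quot1 (rels n r s) (gw' j) * quot1 (rels n r s) (gw' i)"
proof -
  have "gw i * gw j - gw j * gw i \<in> rels n r s" "gw i * gw' j - gw' j * gw i \<in> rels n r s"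
    "gw' i * gw' j - gw' j * gw' i \<in> rels n r s"
    unfolding rels_def using assms by blast+
  then show "quot1 (rels n r s) (gw i) * quot1 (rels n r s) (gw j) = quot1 (rels n r s) (gw j) * quot1 (rels n r s) (gw i)"
    "quot1 (rels n r s) (gw i) * quot1 (rels n r s) (gw' j) = quot1 (rels n r s) (gw' j) * quot1 (rels n r s) (gw i)"
    "quot1 (rels n r s) (gw' i) * quot1 (rels n r s) (gw' j) = quot1 (rels n r s) (gw' j) * quot1 (rels n r s) (gw' i)"
    by (simp_all add: quot1_mult quot1_rels)
qed

lemma (in scalar_algebra) qc_of_conjugation:
  assumes "v * x * v' = c \<star> x" "v' * v = 1"
  shows "qc c v x"
proof -
  have "v * x = v * x * v' * v" using assms(2) by (simp add: mult.assoc)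
  then show ?thesis by (simp add: assms(1) qc_def scale_mult_left)
qed

interpretation U: scalar_algebra quot_scale
  by (rule quot_scalar_algebra)

lemma quot_br: "quot J (x * y - sc c * y * x) = U.br c (quot J x) (quot J y)"
  by (simp only: U.br_def quot_diff quot_sc_mult mult.assoc) (simp only: quot_mult)

lemma torus_weights:
  fixes r s :: "'k::field"
  assumes ij: "i \<in> {1..n}" "j \<in> {1..n}"
  defines "J \<equiv> rels n r s"
  shows "U.qc (pairing n r s i j) (quot1 J (gw j)) (quot J (ge i))"
    "U.qc (inverse (pairing n r s i j)) (quot1 J (gw j)) (quot J (gf i))"
    "U.qc (inverse (pairing n r s j i)) (quot1 J (gw' j)) (quot J (ge i))"
    "U.qc (pairing n r s j i) (quot1 J (gw' j)) (quot J (gf i))"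
proof -
  have *: "gw j * ge i * gwi j - sc (pairing n r s i j) * ge i \<in> J"
    "gw j * gf i * gwi j - sc (inverse (pairing n r s i j)) * gf i \<in> J"
    "gw' j * ge i * gw'i j - sc (inverse (pairing n r s j i)) * ge i \<in> J"
    "gw' j * gf i * gw'i j - sc (pairing n r s j i) * gf i \<in> J"
    unfolding J_def rels_def using ij by blast+
  have conj: "U.qc c (quot1 J v) (quot J x)"
    if "v * x * v' - sc c * x \<in> J" "quot1 J v' * quot1 J v = 1" for v x v' c
  proof (rule U.qc_of_conjugation)
    show "quot1 J v * quot J x * quot1 J v' = quot_scale c (quot J x)"
      using quot_rels[of "v * x * v' - sc c * x" n r s] that(1)
      by (simp add: J_def quot_diff quot_sc_mult quot1_mult_quot quot_mult_quot1)
  qed fact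
  show "U.qc (pairing n r s i j) (quot1 J (gw j)) (quot J (ge i))"
    "U.qc (inverse (pairing n r s i j)) (quot1 J (gw j)) (quot J (gf i))"
    "U.qc (inverse (pairing n r s j i)) (quot1 J (gw' j)) (quot J (ge i))"
    "U.qc (pairing n r s j i) (quot1 J (gw' j)) (quot J (gf i))"
    using conj[OF *(1)] conj[OF *(2)] conj[OF *(3)] conj[OF *(4)]
      torus_inverses[OF ij(2), of r s, folded J_def] by blast+
qed

lemma quot_e_f:
  fixes r s :: "'k::field"
  assumes ij: "i \<in> {1..n}" "j \<in> {1..n}"
  defines "J \<equiv> rels n r s"
  shows "U.br 1 (quot J (ge i)) (quot J (gf j))
    = (if i = j then quot_scale (inverse (rr n r i - rr n s i)) (quot1 J (gw i) - quot1 J (gw' i)) else 0)"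
proof -
  have "ge i * gf j - gf j * ge i
      - (if i = j then sc (inverse (rr n r i - rr n s i)) * (gw i - gw' i) else 0) \<in> J"
    unfolding J_def rels_def using ij by blast
  then have "quot J (ge i * gf j - gf j * ge i
      - (if i = j then sc (inverse (rr n r i - rr n s i)) * (gw i - gw' i) else 0)) = 0"
    unfolding J_def by (rule quot_rels)
  \<comment> \<open>The completing summand \<open>1 - quot J 1\<close> cancels in the
    difference.\<close>
  moreover have "quot1 J (gw i) - quot1 J (gw' i) = quot J (gw i - gw' i)"
    by (simp add: quot1_def quot_diff)
  moreover have "U.br 1 (quot J (ge i)) (quot J (gf j)) = quot J (ge i * gf j - gf j * ge i)"
    by (simp add: U.br_def quot_diff quot_mult)
  ultimately show ?thesis
    by (simp add: quot_diff[of J "ge i * gf j - gf j * ge i"] quot_sc_mult quot_0 split: if_splits)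
qed

text \<open>Reversing the product turns the right adjoint action of \<open>f i\<close> into the form
  \<open>ad\<close> with \<open>w' i\<close> as torus element.\<close>

lemma quot_serre:
  fixes r s :: "'k::field"
  assumes ij: "i \<in> {1..n}" "j \<in> {1..n}" "i \<noteq> j"
  defines "J \<equiv> rels n r s"
  shows "(ad (quot J (ge i)) (quot1 J (gw i)) (quot1 J (gwi i)) ^^ nat (1 - cartan n i j)) (quot J (ge j)) = 0"
    "(ad (Op (quot J (gf i))) (Op (quot1 J (gw' i))) (Op (quot1 J (gw'i i))) ^^ nat (1 - cartan n i j))
      (Op (quot J (gf j))) = 0"
proof -
  have l: "(ad (quot J (ge i)) (quot1 J (gw i)) (quot1 J (gwi i)) ^^ m) (quot J b) = quot J ((adl i ^^ m) b)" for m b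
    by (induction m)
      (simp_all add: ad_def adl_def quot_diff quot_mult_quot1 quot1_mult_quot flip: quot_mult)
  have r: "(ad (Op (quot J (gf i))) (Op (quot1 J (gw' i))) (Op (quot1 J (gw'i i))) ^^ m) (Op (quot J b))
      = Op (quot J ((adr i ^^ m) b))" for m b
    by (induction m)
      (simp_all add: Op_simps ad_def adr_def quot_diff quot_mult_quot1 quot1_mult_quot mult.assoc flip: quot_mult)
  have "(adl i ^^ nat (1 - cartan n i j)) (ge j) \<in> J" "(adr i ^^ nat (1 - cartan n i j)) (gf j) \<in> J"
    unfolding J_def rels_def
    by (rule UnI2, rule UN_I[OF ij(1)], rule UN_I[OF ij(2)], use ij(3) in simp)+
  then show "(ad (quot J (ge i)) (quot1 J (gw i)) (quot1 J (gwi i)) ^^ nat (1 - cartan n i j)) (quot J (ge j)) = 0"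
    "(ad (Op (quot J (gf i))) (Op (quot1 J (gw' i))) (Op (quot1 J (gw'i i))) ^^ nat (1 - cartan n i j))
      (Op (quot J (gf j))) = 0"
    unfolding l r by (simp_all add: J_def quot_rels Op_simps)
qed

lemma Ev_rec:
  assumes "k < j"
  shows "Ev r k j = ge k * Ev r (Suc k) j - sc (r^2) * Ev r (Suc k) j * ge k"
proof -
  have "j - k = Suc (j - Suc k)" "j - Suc (j - Suc k) = k" using assms by simp_all
  then show ?thesis by (simp add: Ev_def)
qed

lemma Epv_rec:
  assumes "j < n"
  shows "Epv n r s k j = Epv n r s k (Suc j) * ge j - sc (inverse (s^2)) * ge j * Epv n r s k (Suc j)"
proof -
  have "n - j = Suc (n - Suc j)" "n - Suc (n - Suc j) = j" using assms by simp_all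
  then show ?thesis by (simp add: Epv_def)
qed

lemma Fv_rec:
  assumes "k < j"
  shows "Fv s k j = Fv s (Suc k) j * gf k - sc (s^2) * gf k * Fv s (Suc k) j"
proof -
  have "j - k = Suc (j - Suc k)" "j - Suc (j - Suc k) = k" using assms by simp_all
  then show ?thesis by (simp add: Fv_def)
qed

lemma Fpv_rec:
  assumes "j < n"
  shows "Fpv n r s k j = gf j * Fpv n r s k (Suc j) - sc (inverse (r^2)) * Fpv n r s k (Suc j) * gf j"
proof -
  have "n - j = Suc (n - Suc j)" "n - Suc (n - Suc j) = j" using assms by simp_all
  then show ?thesis by (simp add: Fpv_def)
qed

lemma Ucentral_if_quot_commutes:
  fixes r s :: "'k::field" and n :: nat
  defines "J \<equiv> rels n r s"
  assumes "\<forall>i\<in>{1..n}. quot J x * quot J (ge i) = quot J (ge i) * quot J x \<and> quot J x * quot J (gf i) = quot J (gf i) * quot J x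
    \<and> quot J x * quot1 J (gw i) = quot1 J (gw i) * quot J x \<and> quot J x * quot1 J (gw' i) = quot1 J (gw' i) * quot J x"
  shows "Ucentral n r s x"
proof (rule Ucentral_if_generators)
  fix g assume g: "gen_idx g \<in> {1..n}"
  have inv: "quot J x * quot1 J (gwi i) = quot1 J (gwi i) * quot J x"
    "quot J x * quot1 J (gw'i i) = quot1 J (gw'i i) * quot J x" if "i \<in> {1..n}" for i
    using bspec[OF assms(2) that] torus_inverses[OF that, of r s, folded J_def]
      commute_inverse[of _ "quot1 J (gw i)"] commute_inverse[of _ "quot1 J (gw' i)"] by blast+
  have "quot J (x * ge i) = quot J (ge i * x)" "quot J (x * gf i) = quot J (gf i * x)"
    "quot J (x * gw i) = quot J (gw i * x)" "quot J (x * gw' i) = quot J (gw' i * x)"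
    "quot J (x * gwi i) = quot J (gwi i * x)" "quot J (x * gw'i i) = quot J (gw'i i * x)"
    if "i \<in> {1..n}" for i
    using bspec[OF assms(2) that] inv[OF that]
    by (simp_all only: quot_mult_quot1 quot1_mult_quot) (simp_all only: quot_mult)
  then have "quot J (x * gn g) = quot J (gn g * x)"
    using g by (cases g) (simp_all add: gen_idx_def)
  then show "x * gn g - gn g * x \<in> ideal_gen (rels n r s)"
    by (simp only: quot_eq_iff J_def)
qed

text \<open>Torus powers are units and live under \<open>quot1\<close>; subtracting 1 leaves all
  commutators unchanged.\<close>

lemma Ucentral_if_quot1_commutes:
  fixes r s :: "'k::field" and n :: nat
  defines "J \<equiv> rels n r s"
  assumes "\<forall>i\<in>{1..n}. quot1 J x * quot J (ge i) = quot J (ge i) * quot1 J x \<and> quot1 J x * quot J (gf i) = quot J (gf i) * quot1 J x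
    \<and> quot1 J x * quot1 J (gw i) = quot1 J (gw i) * quot1 J x \<and> quot1 J x * quot1 J (gw' i) = quot1 J (gw' i) * quot1 J x"
  shows "Ucentral n r s (x - 1)"
proof (rule Ucentral_if_generators)
  fix g assume g: "gen_idx g \<in> {1..n}"
  have inv: "quot1 J x * quot1 J (gwi i) = quot1 J (gwi i) * quot1 J x"
    "quot1 J x * quot1 J (gw'i i) = quot1 J (gw'i i) * quot1 J x" if "i \<in> {1..n}" for i
    using bspec[OF assms(2) that] torus_inverses[OF that, of r s, folded J_def]
      commute_inverse[of _ "quot1 J (gw i)"] commute_inverse[of _ "quot1 J (gw' i)"] by blast+
  have "x * gn g - gn g * x \<in> ideal_gen (rels n r s)"
    using g bspec[OF assms(2), of "gen_idx g"] inv[of "gen_idx g"]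
    unfolding quot_mult_quot1 quot1_mult_quot quot1_mult quot1_eq_iff quot_eq_iff J_def
    by (cases g) (simp_all add: gen_idx_def)
  then show "(x - 1) * gn g - gn g * (x - 1) \<in> ideal_gen (rels n r s)"
    by (simp add: algebra_simps)
qed

section \<open>The opposite algebra and the two models\<close>

interpretation Uop: scalar_algebra "\<lambda>c x. Op (quot_scale c (unop x))"
  by (rule opposite_scalar_algebra[OF quot_scalar_algebra])

lemma Uop_qc: "Uop.qc c (Op x) (Op y) \<longleftrightarrow> U.qc c y x"
  by (simp add: Uop.qc_def U.qc_def Op_simps)

lemma Uop_br: "Uop.br c (Op x) (Op y) = Op (U.br c y x)"
  by (simp add: Uop.br_def U.br_def Op_simps)

text \<open>Reversing the product inverts the weights, and exchanging \<open>r\<close> and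
  \<open>s\<close> with transposition inverts them again, so the opposite algebra satisfies the same
  relations.\<close>

lemma pairing_swap:
  assumes "r \<noteq> 0" "s \<noteq> 0"
  shows "pairing n r s j i * pairing n s r i j = 1"
  using assms by (auto simp: pairing_def field_simps)

lemma U_model:
  fixes r s :: "'k::field"
  assumes "2 \<le> n" "r ^ l = 1" "s ^ l = 1" "r \<noteq> 0" "s \<noteq> 0" "r ^ 3 \<noteq> s ^ 3" "r ^ 4 \<noteq> s ^ 4"
  defines "J \<equiv> rels n r s"
  shows "two_parameter_so quot_scale n l r s (\<lambda>i. quot J (ge i)) (\<lambda>i. quot J (gf i))
    (\<lambda>i. quot1 J (gw i)) (\<lambda>i. quot1 J (gw' i)) (\<lambda>i. quot1 J (gwi i)) (\<lambda>i. quot1 J (gw'i i))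
    (\<lambda>k j. quot J (Ev r k j)) (\<lambda>k j. quot J (Epv n r s k j))"
proof
  fix i j k :: nat
  show "quot J (Ev r j j) = quot J (ge j)" by (simp add: Ev_def)
  show "quot J (Ev r k j) = U.br (r * r) (quot J (ge k)) (quot J (Ev r (Suc k) j))" if "k < j"
    unfolding Ev_rec[OF that] quot_br by (simp add: power2_eq_square)
  show "quot J (Epv n r s k n) = U.br (r * s) (quot J (Ev r k n)) (quot J (ge n))"
    by (simp add: Epv_def quot_br)
  show "quot J (Epv n r s k j) = U.br (inverse (s * s)) (quot J (Epv n r s k (Suc j))) (quot J (ge j))" if "j < n"
    unfolding Epv_rec[OF that] quot_br by (simp add: power2_eq_square)
qed (use assms(1-7) in \<open>simp_all add: J_def torus_inverses torus_commutes torus_weights quot_e_f quot_serre\<close>)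

lemma U_opposite_model:
  fixes r s :: "'k::field"
  assumes "2 \<le> n" "r ^ l = 1" "s ^ l = 1" and nz: "r \<noteq> 0" "s \<noteq> 0" and "r ^ 3 \<noteq> s ^ 3" "r ^ 4 \<noteq> s ^ 4"
  defines "J \<equiv> rels n r s"
  shows "two_parameter_so (\<lambda>c x. Op (quot_scale c (unop x))) n l s r
    (\<lambda>i. Op (quot J (gf i))) (\<lambda>i. Op (quot J (ge i)))
    (\<lambda>i. Op (quot1 J (gw' i))) (\<lambda>i. Op (quot1 J (gw i))) (\<lambda>i. Op (quot1 J (gw'i i))) (\<lambda>i. Op (quot1 J (gwi i)))
    (\<lambda>k j. Op (quot J (Fv s k j))) (\<lambda>k j. Op (quot J (Fpv n r s k j)))"
proof
  fix i j k :: nat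
  show "Op (quot J (Fv s j j)) = Op (quot J (gf j))" by (simp add: Fv_def)
  show "Op (quot J (Fv s k j)) = Uop.br (s * s) (Op (quot J (gf k))) (Op (quot J (Fv s (Suc k) j)))" if "k < j"
    unfolding Fv_rec[OF that] quot_br Uop_br by (simp add: power2_eq_square)
  show "Op (quot J (Fpv n r s k n)) = Uop.br (s * r) (Op (quot J (Fv s k n))) (Op (quot J (gf n)))"
    unfolding Uop_br by (simp add: Fpv_def quot_br mult.commute)
  show "Op (quot J (Fpv n r s k j)) = Uop.br (inverse (r * r)) (Op (quot J (Fpv n r s k (Suc j)))) (Op (quot J (gf j)))"
    if "j < n"
    unfolding Fpv_rec[OF that] quot_br Uop_br by (simp add: power2_eq_square)
  show "Op (quot1 J (gw' i)) * Op (quot1 J (gw'i i)) = 1" "Op (quot1 J (gw i)) * Op (quot1 J (gwi i)) = 1"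
    if "i \<in> {1..n}"
    using torus_inverses[OF that, of r s] by (simp_all add: J_def Op_simps)
  assume ij: "i \<in> {1..n}" "j \<in> {1..n}"
  show "Op (quot1 J (gw' i)) * Op (quot1 J (gw' j)) = Op (quot1 J (gw' j)) * Op (quot1 J (gw' i))"
    "Op (quot1 J (gw' i)) * Op (quot1 J (gw j)) = Op (quot1 J (gw j)) * Op (quot1 J (gw' i))"
    using torus_commutes[OF ij, of r s] torus_commutes[OF ij(2,1), of r s] by (simp_all add: J_def Op_simps)
  note weights = torus_weights[OF ij, of r s, folded J_def]
  have swap: "pairing n r s a b * pairing n s r b a = 1" "inverse (pairing n r s a b) * inverse (pairing n s r b a) = 1" for a b
    using pairing_swap[OF nz, of n a b] by (auto simp flip: inverse_mult_distrib)
  show "Uop.qc (pairing n s r i j) (Op (quot1 J (gw' j))) (Op (quot J (gf i)))"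
    unfolding Uop_qc using U.qc_sym[OF weights(4)] swap by blast
  show "Uop.qc (inverse (pairing n s r i j)) (Op (quot1 J (gw' j))) (Op (quot J (ge i)))"
    unfolding Uop_qc using U.qc_sym[OF weights(3)] swap by blast
  show "Uop.qc (inverse (pairing n s r j i)) (Op (quot1 J (gw j))) (Op (quot J (gf i)))"
    unfolding Uop_qc using U.qc_sym[OF weights(2)] swap by blast
  show "Uop.qc (pairing n s r j i) (Op (quot1 J (gw j))) (Op (quot J (ge i)))"
    unfolding Uop_qc using U.qc_sym[OF weights(1)] swap by blast
  show "Uop.br 1 (Op (quot J (gf i))) (Op (quot J (ge j))) =
      (if i = j then Op (quot_scale (inverse (rr n s i - rr n r i)) (unop (Op (quot1 J (gw' i)) - Op (quot1 J (gw i)))))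
       else 0)"
  proof -
    \<comment> \<open>Exchanging \<open>r\<close> and \<open>s\<close> changes the sign of this
      scalar, which the exchanged order of the torus elements compensates.\<close>
    have "inverse (rr n s i - rr n r i) = - inverse (rr n r i - rr n s i)"
      by (simp flip: inverse_minus_eq)
    then show ?thesis
      unfolding Uop_br quot_e_f[OF ij(2,1), of r s, folded J_def]
      by (cases "i = j") (auto simp: Op_simps U.scale_right_diff_distrib)
  qed
qed (use assms(1-7) in \<open>simp_all add: J_def quot_serre\<close>)

theorem theorem3p15:
  fixes r s :: "'k::field_char_0" and n d d' :: nat
  assumes "n \<ge> 2"
    and "primitive_root d r" and "primitive_root d' s"
    and "r ^ 3 \<noteq> s ^ 3" and "r ^ 4 \<noteq> s ^ 4"
  shows "(\<forall>k j. 1 \<le> k \<and> k \<le> j \<and> j \<le> n \<longrightarrow>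
            Ucentral n r s (Ev r k j ^ lcm d d') \<and> Ucentral n r s (Fv s k j ^ lcm d d'))
       \<and> (\<forall>k j. 1 \<le> k \<and> k < j \<and> j \<le> n \<longrightarrow>
            Ucentral n r s (Epv n r s k j ^ lcm d d') \<and> Ucentral n r s (Fpv n r s k j ^ lcm d d'))
       \<and> (\<forall>k. 1 \<le> k \<and> k \<le> n \<longrightarrow>
            Ucentral n r s (gw k ^ lcm d d' - 1) \<and> Ucentral n r s (gw' k ^ lcm d d' - 1))"
proof -
  define l where "l = lcm d d'"
  define J where "J = rels n r s"
  have d: "d > 0" "d' > 0" "r ^ d = 1" "s ^ d' = 1" using assms(2,3) by (auto simp: primitive_root_def)
  then have l: "l > 0" by (simp add: l_def lcm_pos_nat)
  have root: "r ^ l = 1" "s ^ l = 1"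
  proof -
    obtain a b where "l = d * a" "l = d' * b"
      using dvd_lcm1[of d d'] dvd_lcm2[of d' d] unfolding l_def by (meson dvdE)
    then show "r ^ l = 1" "s ^ l = 1" using d by (metis power_mult power_one)+
  qed
  have nz: "r \<noteq> 0" "s \<noteq> 0" using d by (auto simp: power_0_left)
  interpret P: two_parameter_so quot_scale n l r s "\<lambda>i. quot J (ge i)" "\<lambda>i. quot J (gf i)"
    "\<lambda>i. quot1 J (gw i)" "\<lambda>i. quot1 J (gw' i)" "\<lambda>i. quot1 J (gwi i)" "\<lambda>i. quot1 J (gw'i i)"
    "\<lambda>k j. quot J (Ev r k j)" "\<lambda>k j. quot J (Epv n r s k j)"
    unfolding J_def by (rule U_model[OF assms(1) root nz assms(4,5)])
  interpret N: two_parameter_so "\<lambda>c x. Op (quot_scale c (unop x))" n l s r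
    "\<lambda>i. Op (quot J (gf i))" "\<lambda>i. Op (quot J (ge i))"
    "\<lambda>i. Op (quot1 J (gw' i))" "\<lambda>i. Op (quot1 J (gw i))" "\<lambda>i. Op (quot1 J (gw'i i))" "\<lambda>i. Op (quot1 J (gwi i))"
    "\<lambda>k j. Op (quot J (Fv s k j))" "\<lambda>k j. Op (quot J (Fpv n r s k j))"
    unfolding J_def by (rule U_opposite_model[OF assms(1) root nz assms(4,5)])
  have "Ucentral n r s (Ev r k j ^ l)" "Ucentral n r s (Fv s k j ^ l)" if "1 \<le> k" "k \<le> j" "j \<le> n" for k j
    by (rule Ucentral_if_quot_commutes,
        use P.E_power_commutes[OF that] N.E_power_commutes[OF that] l in
          \<open>simp add: J_def quot_power U.qc_1 Uop_qc Op_power\<close>)+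
  moreover have "Ucentral n r s (Epv n r s k j ^ l)" "Ucentral n r s (Fpv n r s k j ^ l)"
    if "1 \<le> k" "k < j" "j \<le> n" for k j
    by (rule Ucentral_if_quot_commutes,
        use P.E'_power_commutes[OF that] N.E'_power_commutes[OF that] l in
          \<open>simp add: J_def quot_power U.qc_1 Uop_qc Op_power\<close>)+
  \<comment> \<open>\<open>P\<close> gives the first family and \<open>N\<close> the second.\<close>
  moreover have "Ucentral n r s (gw k ^ l - 1)" "Ucentral n r s (gw' k ^ l - 1)" if "k \<in> {1..n}" for k
    by (rule Ucentral_if_quot1_commutes,
        use P.w_power_commutes[OF that] N.w_power_commutes[OF that] in
          \<open>simp add: J_def quot1_power U.qc_1 Uop_qc Op_power\<close>)+
  ultimately show ?thesis by (simp add: l_def)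
qed

end
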